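(* Fix integers $T,L\geq 1$ and $0<\varepsilon,\nu<1$. There exists a constant $C=C(T,L,\varepsilon,\nu)>0$ such that the following holds. Let $N=tq$, where $t,q$ are positive integers with $1\leq t\leq T$, $(t,q)=1$ and $\Omega(q)\leq L$, and let $A\subseteq\mathbb Z_N$ have size $n\geq 2$. Then at least one of the following alternatives holds: (i) there exist a proper $q$-large subgroup $H<\mathbb Z_N$ and a coset $a+H$ such that $|A\cap(a+H)|\geq(1-\nu)n$; (ii) for every integer $m$ satisfying $1\leq m\leq(1-\varepsilon)n$, for a uniformly random $m$-subset $R$ of $A$, and for every $z\in\mathbb Z_N$, one has $$\Pr[\Sigma(R)=z]\leq\frac1N+C\,\frac{\sqrt{\log(2+n)}}{n\sqrt m}.$$ When $q=1$, alternative (i) is impossible.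
   Context: $\Omega(q)$ is the number of prime factors of $q$ counted with multiplicity. A subgroup $H$ of $\mathbb Z_N$ (with $N=tq$) is called $q$-large if $|H|$ is divisible by a prime factor of $q$. $\Sigma(R)=\sum_{x\in R}x$. $\log$ is the natural logarithm. *)

theory Defs
  imports
    "HOL-Algebra.FiniteProduct"
    "HOL-Algebra.Elementary_Groups"
    "HOL-Computational_Algebra.Primes"
    "HOL-Probability.Probability_Mass_Function"
begin

definition num_prime_factors :: "nat \<Rightarrow> nat" where
  "num_prime_factors q = size (prime_factorization q)"

definition q_large :: "nat \<Rightarrow> int set \<Rightarrow> bool" where
  "q_large q H \<longleftrightarrow> (\<exists>p \<in> prime_factors q. p dvd card H)"

text \<open>
  The product \<open>finprod\<close> of the (additively interpreted) monoid \<open>integer_mod_group N\<close>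
  is the sum modulo \<open>N\<close>.
\<close>

definition set_sum :: "nat \<Rightarrow> int set \<Rightarrow> int" where
  "set_sum N R = finprod (integer_mod_group N) (\<lambda>x. x) R"

text \<open>
  Only meaningful for finite \<open>A\<close> and \<open>m \<le> card A\<close>, since \<open>pmf_of_set\<close> is
  unspecified on empty or infinite sets.
\<close>

definition unif_subset :: "nat \<Rightarrow> 'a set \<Rightarrow> 'a set pmf" where
  "unif_subset m A = pmf_of_set {R. R \<subseteq> A \<and> card R = m}"

definition concentrated_on_coset :: "nat \<Rightarrow> nat \<Rightarrow> real \<Rightarrow> int set \<Rightarrow> bool" where
  "concentrated_on_coset N q \<nu> A \<longleftrightarrow>
     (\<exists>H a. subgroup H (integer_mod_group N) \<and> H \<noteq> carrier (integer_mod_group N) \<and>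
        q_large q H \<and> a \<in> carrier (integer_mod_group N) \<and>
        real (card (A \<inter> (a <#\<^bsub>integer_mod_group N\<^esub> H))) \<ge> (1 - \<nu>) * real (card A))"

end

(*
  By Fourier inversion, the probability exceeds 1/N by at most the average over the frequencies
  k <> 0 of |E w(k Sigma(R))|, where w(x) = exp(2 pi i x / N). Extracting the m-th elementary
  symmetric polynomial from prod_a ((1-p) + p z w(ka)) with p = m/n bounds such a term by a constant
  times exp(-c m s(k)^2), where n s(k) is the L2 norm over (a,b) in A x A of sin(pi k (a-b) / N).
  As s is subadditive, j-fold sumsets of {s <= u} lie in {s <= j u}. By Parseval, {s <= s0} has at
  most 2N/n elements. If it contains a nontrivial subgroup K, then A is concentrated on a coset of
  the annihilator of K; otherwise Olson's inequality |X + B| >= |X| + |B|/2 gives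
  |{0 <> k, s(k) <= u}| <= 8 N u / (n s0), and summing over layers of width 1/sqrt m yields
  O(N / (n sqrt m)) plus N exp(-c m s0^2). The last term is harmless for m >> log n; for smaller m
  the trivial bound 1/(n-m+1), from fixing all but one element of R, suffices.
  A proper subgroup that is not q-large has order at most t <= T, so concentration on one of its
  cosets forces n to be bounded.
*)
theory Submission
  imports Defs "HOL-Analysis.Analysis" "HOL-Algebra.Generated_Groups"
begin

subsection \<open>Growth of product sets in abelian groups\<close>

text \<open>The obstacle is the number of frequencies of small defect. Parseval alone bounds it by
  2N/n at every scale, which would leave an error 1/n without the gain 1/sqrt m; a count that is
  linear in the scale is needed. Growth of sumsets supplies it, but only as long as they have not
  filled a subgroup, which is why a nontrivial subgroup inside a level set is the exceptional case
  and leads to alternative (i). The logarithm has a single source. Frequencies of large defect are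
  all charged exp(-c m s0^2), which drops below 1 / (n sqrt m) once m exceeds a constant times log
  n. Below that threshold sqrt m is itself O(sqrt(log n)), so the trivial bound 1 / (eps n) is
  O(sqrt(log n) / (n sqrt m)).\<close>

lemma (in group) l_coset_conv_image: "g <# X = (\<lambda>x. g \<otimes> x) ` X"
  by (auto simp: l_coset_def)

lemma (in group) card_l_coset:
  assumes "g \<in> carrier G" "X \<subseteq> carrier G"
  shows "card (g <# X) = card X"
  unfolding l_coset_conv_image using assms by (intro card_image inj_onI) (auto simp: subset_iff)

lemma (in group) subset_set_mult_one:
  assumes "X \<subseteq> carrier G" "\<one> \<in> B"
  shows "X \<subseteq> X <#> B"
  using assms by (force simp: set_mult_def)

lemma (in group) mult_mem_set_mult_iff:
  assumes "\<And>b. b \<in> B \<Longrightarrow> inv b \<in> B" "B \<subseteq> carrier G" "X \<subseteq> carrier G" "x \<in> carrier G"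
  shows "x \<in> X <#> B \<longleftrightarrow> (\<exists>b\<in>B. x \<otimes> b \<in> X)"
proof
  assume "x \<in> X <#> B"
  then obtain y b where "y \<in> X" "b \<in> B" "x = y \<otimes> b" by (auto simp: set_mult_def)
  then show "\<exists>b\<in>B. x \<otimes> b \<in> X" using assms
    by (intro bexI[of _ "inv b"]) (auto simp: m_assoc subset_iff)
next
  assume "\<exists>b\<in>B. x \<otimes> b \<in> X"
  then obtain b where b: "b \<in> B" "x \<otimes> b \<in> X" by blast
  then have "x = (x \<otimes> b) \<otimes> inv b" using assms by (auto simp: m_assoc subset_iff)
  then show "x \<in> X <#> B" using b assms(1) by (auto simp: set_mult_def)
qed

text \<open>Olson's inequality, by Hamidoune's method: among the sets with smallest boundary,
  those of smallest cardinality (the atoms) are pairwise equal or disjoint, so an atom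
  containing the unit is a subgroup, for which the inequality is immediate.\<close>

locale generating_set = comm_group G for G (structure) +
  fixes B :: "'a set"
  assumes finite_carrier: "finite (carrier G)"
    and B_subset: "B \<subseteq> carrier G" and one_in_B: "\<one> \<in> B"
    and inv_B: "\<And>b. b \<in> B \<Longrightarrow> inv b \<in> B"
    and generates: "\<And>H. subgroup H G \<Longrightarrow> B \<subseteq> H \<Longrightarrow> H = carrier G"
begin

definition proper :: "'a set \<Rightarrow> bool" where
  "proper X \<longleftrightarrow> X \<subseteq> carrier G \<and> X \<noteq> {} \<and> X <#> B \<noteq> carrier G"

definition bdry :: "'a set \<Rightarrow> int" where
  "bdry X = int (card (X <#> B)) - int (card X)"

definition atom :: "'a set \<Rightarrow> bool" where
  "atom X \<longleftrightarrow> proper X \<and> (\<forall>Y. proper Y \<longrightarrow> bdry X \<le> bdry Y \<and> (bdry Y = bdry X \<longrightarrow> card X \<le> card Y))"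

lemma atomD:
  assumes "atom X"
  shows "X \<subseteq> carrier G" "X \<noteq> {}" "X <#> B \<noteq> carrier G"
    "proper Y \<Longrightarrow> bdry X \<le> bdry Y" "proper Y \<Longrightarrow> bdry Y \<le> bdry X \<Longrightarrow> card X \<le> card Y"
proof -
  show "X \<subseteq> carrier G" "X \<noteq> {}" "X <#> B \<noteq> carrier G"
    using assms by (simp_all add: atom_def proper_def)
  show "proper Y \<Longrightarrow> bdry X \<le> bdry Y" "proper Y \<Longrightarrow> bdry Y \<le> bdry X \<Longrightarrow> card X \<le> card Y"
    using assms by (auto simp: atom_def)
qed

lemma finite_sub: "X \<subseteq> carrier G \<Longrightarrow> finite X"
  using finite_carrier by (rule finite_subset[rotated])

lemma set_mult_B: "X \<subseteq> carrier G \<Longrightarrow> X <#> B \<subseteq> carrier G" "X \<subseteq> carrier G \<Longrightarrow> X \<subseteq> X <#> B"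
  using set_mult_closed[OF _ B_subset] subset_set_mult_one[OF _ one_in_B] by blast+

lemma bdry_nonneg: "X \<subseteq> carrier G \<Longrightarrow> bdry X \<ge> 0"
  unfolding bdry_def using card_mono[OF finite_sub set_mult_B(2)] set_mult_B(1) by simp

lemma atom_exists:
  assumes "proper X"
  obtains F where "atom F"
proof -
  \<comment> \<open>The boundary is weighted by more than any cardinality, so a minimum of
    \<open>f\<close> is lexicographic: smallest boundary first, then smallest set.\<close>
  define f where "f Y = nat (bdry Y) * (card (carrier G) + 1) + card Y" for Y
  obtain F where F: "proper F" "\<And>Y. proper Y \<Longrightarrow> f F \<le> f Y"
    using ex_has_least_nat[of proper X f] assms by blast
  have "atom F"
    unfolding atom_def
  proof (intro conjI allI impI)
    fix Y assume Y: "proper Y"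
    have FY: "f F \<le> f Y" using F Y by blast
    have sub: "F \<subseteq> carrier G" "Y \<subseteq> carrier G" using F(1) Y by (auto simp: proper_def)
    have c: "card Y \<le> card (carrier G)" using sub card_mono finite_carrier by blast
    show "bdry F \<le> bdry Y"
    proof (rule ccontr)
      assume "\<not> ?thesis"
      then have "nat (bdry Y) + 1 \<le> nat (bdry F)" using bdry_nonneg[of Y] sub by linarith
      then have "(nat (bdry Y) + 1) * (card (carrier G) + 1) \<le> nat (bdry F) * (card (carrier G) + 1)"
        by (rule mult_le_mono1)
      then show False using FY c by (simp add: f_def)
    qed
    show "card F \<le> card Y" if "bdry Y = bdry F" using FY that by (simp add: f_def)
  qed (use F in auto)
  then show ?thesis using that by blast
qed

lemma atom_l_coset:
  assumes "atom F" "g \<in> carrier G"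
  shows "atom (g <# F)"
proof -
  note F = atomD[OF assms(1)]
  have sub: "g <# F \<subseteq> carrier G" using F assms l_coset_subset_G by blast
  have eq: "(g <# F) <#> B = g <# (F <#> B)"
    using F assms B_subset by (intro setmult_lcos_assoc)
  have c: "card (g <# F) = card F" "card (g <# (F <#> B)) = card (F <#> B)"
    using F set_mult_B assms card_l_coset by auto
  have "card (F <#> B) < card (carrier G)"
    using F set_mult_B finite_carrier by (metis psubsetI psubset_card_mono)
  then have "(g <# F) <#> B \<noteq> carrier G" using eq c by auto
  moreover have "g <# F \<noteq> {}" using F by (auto simp: l_coset_def)
  ultimately have "proper (g <# F)" using sub by (auto simp: proper_def)
  moreover have "bdry (g <# F) = bdry F" by (simp add: bdry_def eq c)
  ultimately show ?thesis using assms(1) c by (simp add: atom_def)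
qed

text \<open>The boundary is submodular. If the atoms meet but differ, \<open>F \<inter> E\<close> is
  proper and smaller than \<open>F\<close>, so its boundary exceeds that of \<open>F\<close>; the
  boundary of \<open>F \<union> E\<close> is then strictly below it, impossible for a proper set.
  What remains is a union that expands to the whole group, and counting excludes this.\<close>

lemma atoms_disjoint:
  assumes "atom F" "atom E" "F \<inter> E \<noteq> {}"
  shows "F = E"
proof (rule ccontr)
  assume ne: "F \<noteq> E"
  note F = atomD[OF assms(1)] and E = atomD[OF assms(2)]
  have pF: "proper F" and pE: "proper E" using assms by (auto simp: atom_def)
  have bd: "bdry E = bdry F" using F(4)[OF pE] E(4)[OF pF] by simp
  have cd: "card E = card F" using F(5)[OF pE] E(5)[OF pF] bd by simp
  have fin: "finite F" "finite E" "finite (F <#> B)" "finite (E <#> B)"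
    using F(1) E(1) finite_sub set_mult_B(1) by auto
  have int: "(F \<inter> E) <#> B \<subseteq> (F <#> B) \<inter> (E <#> B)" by (auto simp: set_mult_def)
  have un: "(F \<union> E) <#> B = (F <#> B) \<union> (E <#> B)" by (auto simp: set_mult_def)
  have "proper (F \<inter> E)"
  proof -
    have "(F \<inter> E) <#> B \<noteq> carrier G"
      using int F(3) set_mult_B(1)[OF F(1)] by blast
    then show ?thesis using F(1) assms(3) unfolding proper_def by blast
  qed
  moreover have "card (F \<inter> E) < card F"
  proof -
    have "F \<inter> E \<noteq> F" using ne cd fin by (metis card_subset_eq inf.cobounded2)
    then show ?thesis using fin by (intro psubset_card_mono) auto
  qed
  ultimately have bi: "bdry (F \<inter> E) > bdry F" using F(5)[of "F \<inter> E"] by linarith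
  have ci: "card ((F \<inter> E) <#> B) \<le> card ((F <#> B) \<inter> (E <#> B))"
    using int fin by (intro card_mono) auto
  have cu: "card (F \<union> E) + card (F \<inter> E) = card F + card E"
    using card_Un_Int[OF fin(1,2)] by simp
  have cu2: "card ((F \<union> E) <#> B) + card ((F <#> B) \<inter> (E <#> B)) = card (F <#> B) + card (E <#> B)"
    using card_Un_Int[OF fin(3,4)] un by simp
  have bu: "bdry (F \<union> E) < bdry F"
    using bi ci cu cu2 bd unfolding bdry_def by linarith
  then have "\<not> proper (F \<union> E)" using F(4) by force
  then have full: "(F \<union> E) <#> B = carrier G" using F(1,2) E(1) unfolding proper_def by auto
  txt \<open>Because \<open>B\<close> is symmetric, the complement \<open>D\<close> of \<open>F <#> B\<close> has boundary at most that of \<open>F\<close>;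
    being at least as large as the atom \<open>F\<close>, it leaves no room for \<open>F \<union> E\<close> to be that big.\<close>
  define D where "D = carrier G - (F <#> B)"
  have "D \<noteq> {}"
    unfolding D_def using F(3) set_mult_B(1)[OF F(1)] by blast
  then have D: "D \<subseteq> carrier G" "D \<noteq> {}" by (auto simp: D_def)
  have DB: "D <#> B \<subseteq> carrier G - F"
  proof
    fix x assume x: "x \<in> D <#> B"
    have xc: "x \<in> carrier G" using x set_mult_B D by blast
    then obtain b where b: "b \<in> B" "x \<otimes> b \<in> D"
      using x mult_mem_set_mult_iff[OF inv_B B_subset D(1)] by blast
    have "x \<notin> F" using b by (auto simp: D_def set_mult_def)
    then show "x \<in> carrier G - F" using xc by blast
  qed
  have "proper D" using D DB F(1,2) unfolding proper_def by blast
  moreover have cD: "card D + card (F <#> B) = card (carrier G)"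
    unfolding D_def using finite_carrier set_mult_B F(1)
    by (simp add: card_Diff_subset card_mono fin(3) finite_carrier)
  moreover have "card (D <#> B) + card F \<le> card (carrier G)"
    using card_mono[OF _ DB] finite_carrier F(1) fin
    by (simp add: card_Diff_subset) (metis Nat.le_diff_conv2 card_mono)
  ultimately have "card F \<le> card D"
    by (intro F(5)) (auto simp: bdry_def)
  \<comment> \<open>Since |G| = |F B| + |D| and |D| >= |F|, this makes |G| - |F u E| exceed |F B| -
    |F|, against \<open>bu\<close>.\<close>
  moreover have "card (F \<union> E) < 2 * card F"
    using cu cd card_gt_0_iff[of "F \<inter> E"] assms(3) fin by simp
  ultimately show False
    using bu full cD unfolding bdry_def by simp
qed

text \<open>Translating an atom by the inverse of one of its elements gives an atom that contains
  the unit. It meets \<open>F\<close> there, so it is \<open>F\<close> itself.\<close>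

lemma atom_subgroup:
  assumes "atom F" "\<one> \<in> F"
  shows "subgroup F G"
proof -
  note F = atomD[OF assms(1)]
  have tr: "inv x <# F = F" if "x \<in> F" for x
  proof -
    have x: "x \<in> carrier G" using that F(1) by blast
    have "\<one> = inv x \<otimes> x" using x by simp
    then have "\<one> \<in> inv x <# F" using that unfolding l_coset_conv_image by blast
    then show ?thesis using atoms_disjoint[OF atom_l_coset[OF assms(1)] assms(1)] x assms(2) by auto
  qed
  have q: "inv x \<otimes> y \<in> F" if "x \<in> F" "y \<in> F" for x y
    using tr[OF that(1)] that(2) unfolding l_coset_conv_image by blast
  have i: "inv x \<in> F" if "x \<in> F" for x
    using q[OF that assms(2)] that F(1) by auto
  show ?thesis
  proof (rule subgroupI)
    show "x \<otimes> y \<in> F" if "x \<in> F" "y \<in> F" for x y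
      using q[OF i[OF that(1)] that(2)] that F(1) by auto
  qed (use F(1,2) i in auto)
qed

text \<open>It suffices to bound the boundary of a subgroup atom \<open>H\<close> below by |B|/2.
  Since \<open>B\<close> generates the group it leaves \<open>H\<close>, so H B contains two
  disjoint cosets of \<open>H\<close>; it also contains \<open>B\<close>. Hence |H B| - |H| >= |H
  B|/2 >= |B|/2.\<close>

theorem card_set_mult_ge:
  assumes "X \<subseteq> carrier G" "X \<noteq> {}" "X <#> B \<noteq> carrier G"
  shows "2 * card X + card B \<le> 2 * card (X <#> B)"
proof -
  have pX: "proper X" using assms by (auto simp: proper_def)
  obtain F0 where F0: "atom F0" using atom_exists[OF pX] .
  obtain x where x: "x \<in> F0" "x \<in> carrier G" using atomD[OF F0] by blast
  define H where "H = inv x <# F0"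
  have aH: "atom H" unfolding H_def using F0 x by (intro atom_l_coset) auto
  have oneH: "\<one> \<in> H" unfolding H_def l_coset_conv_image using x
    by (metis imageI l_inv)
  have sH: "subgroup H G" using atom_subgroup[OF aH oneH] .
  note H = atomD[OF aH]
  have finH: "finite H" "finite (H <#> B)" using H(1) finite_sub set_mult_B(1) by auto
  have "H \<noteq> carrier G" using H set_mult_B(2)[OF H(1)] set_mult_B(1)[OF H(1)] by auto
  then obtain b where b: "b \<in> B" "b \<notin> H" using generates[OF sH] by blast
  have bc: "b \<in> carrier G" using b B_subset by blast
  have "H \<inter> (b <# H) = {}"
  proof (rule ccontr)
    assume "H \<inter> (b <# H) \<noteq> {}"
    then have "H = b <# H" using atoms_disjoint[OF aH atom_l_coset[OF aH bc]] by blast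
    moreover have "b \<in> b <# H" unfolding l_coset_conv_image using oneH bc
      by (metis imageI r_one)
    ultimately show False using b by blast
  qed
  then have "card (H \<union> (b <# H)) = 2 * card H"
    using finH card_l_coset[OF bc H(1)] by (simp add: card_Un_disjoint l_coset_conv_image)
  moreover have "H \<union> (b <# H) \<subseteq> H <#> B"
    using set_mult_B(2)[OF H(1)] b bc H(1) by (auto simp: l_coset_conv_image set_mult_def) (metis m_comm subsetD)
  ultimately have h2: "2 * card H \<le> card (H <#> B)" using finH card_mono by metis
  have "B \<subseteq> H <#> B" using oneH B_subset by (force simp: set_mult_def)
  then have hB: "card B \<le> card (H <#> B)" using finH card_mono by metis
  have "bdry H \<le> bdry X" using H(4) pX by blast
  then show ?thesis using h2 hB unfolding bdry_def by linarith
qed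

end

text \<open>Olson's inequality stops when the product set fills the group, so it is applied inside
  the subgroup \<open>U\<close> generated by \<open>B\<close>. No iterate up to \<open>j\<close> is
  all of \<open>U\<close>: otherwise \<open>U\<close> would be a nontrivial subgroup within the last
  iterate. Each factor thus adds half of \<open>card B\<close>.\<close>

lemma (in comm_group) card_iterated_set_mult_ge:
  assumes fin: "finite (carrier G)" and B: "B \<subseteq> carrier G" "\<one> \<in> B" "\<And>b. b \<in> B \<Longrightarrow> inv b \<in> B" "B \<noteq> {\<one>}"
    and nosub: "\<And>K. subgroup K G \<Longrightarrow> K \<subseteq> ((\<lambda>X. X <#> B) ^^ j) {\<one>} \<Longrightarrow> K = {\<one>}"
  shows "j * card B \<le> 2 * card (((\<lambda>X. X <#> B) ^^ j) {\<one>})"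
proof -
  define P where "P i = ((\<lambda>X. X <#> B) ^^ i) {\<one>}" for i
  define U where "U = generate G B"
  have sU: "subgroup U G" unfolding U_def using B(1) by (rule generate_is_subgroup)
  have BU: "B \<subseteq> U" unfolding U_def by (auto intro: generate.incl)
  have Une: "U \<noteq> {\<one>}" using BU B by blast
  have P0: "P 0 = {\<one>}" and PS: "P (Suc i) = P i <#> B" for i by (auto simp: P_def)
  have PU: "P i \<subseteq> U" "P i \<noteq> {}" for i
  proof (induction i)
    case (Suc i)
    show "P (Suc i) \<subseteq> U" unfolding PS using Suc BU sU by (auto simp: set_mult_def dest: subgroup.m_closed)
    show "P (Suc i) \<noteq> {}" unfolding PS using Suc B by (auto simp: set_mult_def)
  qed (use sU in \<open>auto simp: P0 subgroup.one_closed\<close>)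
  have UG: "U \<subseteq> carrier G" using sU by (rule subgroup.subset)
  have mono: "P i \<subseteq> P (Suc i)" for i unfolding PS
    using subset_set_mult_one PU UG B by (metis subset_trans)
  have Pj: "P i \<subseteq> P j" if "i \<le> j" for i using that mono by (rule lift_Suc_mono_le[rotated]) 
  have ne: "P i \<noteq> U" if "i \<le> j" for i
  proof
    assume "P i = U"
    then have "U = {\<one>}" using Pj[OF that] nosub[OF sU] unfolding P_def by simp
    then show False using Une by blast
  qed
  interpret U: generating_set "G\<lparr>carrier := U\<rparr>" B
  proof (unfold generating_set_def, intro conjI)
    show "comm_group (G\<lparr>carrier := U\<rparr>)" 
      using subgroup_imp_group[OF sU] UG by (intro group.group_comm_groupI) (auto simp: m_comm subset_iff)
    show "generating_set_axioms (G\<lparr>carrier := U\<rparr>) B"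
    proof
      show "inv\<^bsub>G\<lparr>carrier := U\<rparr>\<^esub> b \<in> B" if "b \<in> B" for b
        using that B BU m_inv_consistent[OF sU] by auto
      fix H assume H: "subgroup H (G\<lparr>carrier := U\<rparr>)" "B \<subseteq> H"
      have "subgroup H G" using H sU incl_subgroup by blast
      then have "U \<subseteq> H" unfolding U_def using H(2) generate_subgroup_incl by blast
      then show "H = carrier (G\<lparr>carrier := U\<rparr>)" using subgroup.subset[OF H(1)] by auto
    qed (use fin UG B BU in \<open>auto intro: finite_subset\<close>)
  qed
  have "i \<le> j \<Longrightarrow> i * card B \<le> 2 * card (P i)" for i
  proof (induction i)
    case (Suc i)
    have "2 * card (P i) + card B \<le> 2 * card (P i <#>\<^bsub>G\<lparr>carrier := U\<rparr>\<^esub> B)"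
      using PU ne[OF Suc.prems] PS by (intro U.card_set_mult_ge) auto
    then show ?case using Suc by (simp add: PS)
  qed simp
  then show ?thesis by (simp add: P_def)
qed

subsection \<open>Characters of the integers modulo \<open>N\<close>\<close>

definition root_char :: "nat \<Rightarrow> int \<Rightarrow> complex" where
  "root_char N x = cis (2 * pi * of_int x / real N)"

lemma root_char_0 [simp]: "root_char N 0 = 1"
  by (simp add: root_char_def)

lemma norm_root_char [simp]: "cmod (root_char N x) = 1"
  by (simp add: root_char_def)

lemma root_char_add: "root_char N (x + y) = root_char N x * root_char N y"
  by (simp add: root_char_def cis_mult add_divide_distrib algebra_simps)

lemma root_char_uminus: "root_char N (- x) = cnj (root_char N x)"
  by (simp add: root_char_def cis_cnj)

lemma root_char_diff: "root_char N (x - y) = root_char N x * cnj (root_char N y)"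
  using root_char_add[of N x "- y"] by (simp add: root_char_uminus)

lemma root_char_sum: "root_char N (\<Sum>x\<in>A. f x) = (\<Prod>x\<in>A. root_char N (f x))"
  by (induction A rule: infinite_finite_induct) (auto simp: root_char_add)

lemma root_char_of_nat_mult: "root_char N (int j * x) = root_char N x ^ j"
  by (induction j) (auto simp: root_char_add distrib_right)

lemma root_char_eq_1_iff:
  assumes "N > 0"
  shows "root_char N x = 1 \<longleftrightarrow> int N dvd x"
proof
  assume "root_char N x = 1"
  then have "cos (2 * pi * of_int x / real N) = 1"
    by (simp add: root_char_def complex_eq_iff)
  then obtain l :: int where "2 * pi * of_int x / real N = l * 2 * pi"
    by (auto simp: cos_one_2pi_int)
  then have "real_of_int x = real_of_int (l * int N)" using assms by (simp add: field_simps)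
  then have "x = l * int N" by (simp only: of_int_eq_iff)
  then show "int N dvd x" by simp
next
  assume "int N dvd x"
  then obtain l where "x = int N * l" by blast
  then have "root_char N x = cis (2 * pi * of_int l)" using assms by (simp add: root_char_def mult.assoc)
  also have "\<dots> = 1" by (rule cis_multiple_2pi) simp
  finally show "root_char N x = 1" .
qed

lemma sum_root_char:
  assumes "N > 0"
  shows "(\<Sum>k\<in>{0..<int N}. root_char N (k * x)) = (if int N dvd x then of_nat N else 0)"
proof -
  have "(\<Sum>k\<in>{0..<int N}. root_char N (k * x)) = (\<Sum>k<N. root_char N (int k * x))"
    by (rule sum.reindex_bij_witness[of _ int nat]) auto
  also have "\<dots> = (\<Sum>k<N. root_char N x ^ k)"
    by (simp add: root_char_of_nat_mult)
  also have "\<dots> = (if int N dvd x then of_nat N else 0)"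
  proof (cases "int N dvd x")
    case True
    then have "root_char N x = 1" using root_char_eq_1_iff[OF assms] by simp
    then show ?thesis using True by simp
  next
    case False
    then have ne: "root_char N x \<noteq> 1" using root_char_eq_1_iff[OF assms] by simp
    have "root_char N x ^ N = 1"
      using root_char_eq_1_iff[OF assms, of "int N * x"] by (simp add: root_char_of_nat_mult)
    then show ?thesis using False ne by (simp add: geometric_sum)
  qed
  finally show ?thesis .
qed

text \<open>Orthogonality of characters detects the residue \<open>z\<close>. Frequency 0
  contributes exactly \<open>card F\<close>, the source of the term 1/N; at the others
  \<open>z\<close> enters only through a factor of modulus 1.\<close>

lemma card_fibre_mod_le:
  fixes g :: "'b \<Rightarrow> int"
  assumes "N > 0" "finite F" "z \<in> {0..<int N}"
  shows "real N * real (card {R \<in> F. g R mod int N = z})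
    \<le> real (card F) + (\<Sum>k\<in>{1..<int N}. cmod (\<Sum>R\<in>F. root_char N (k * g R)))"
proof -
  have "of_nat (N * card {R \<in> F. g R mod int N = z}) =
      (\<Sum>R\<in>F. if g R mod int N = z then of_nat N else (0::complex))"
    using assms(2) by (simp add: sum.If_cases Int_def)
  also have "\<dots> = (\<Sum>R\<in>F. \<Sum>k\<in>{0..<int N}. root_char N (k * (g R - z)))"
  proof (rule sum.cong[OF refl])
    fix R
    have "g R mod int N = z \<longleftrightarrow> int N dvd (g R - z)"
      using assms(3) by (metis atLeastLessThan_iff mod_eq_dvd_iff mod_pos_pos_trivial)
    then show "(if g R mod int N = z then of_nat N else (0::complex)) =
        (\<Sum>k\<in>{0..<int N}. root_char N (k * (g R - z)))"
      using sum_root_char[OF assms(1)] by simp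
  qed
  also have "\<dots> = (\<Sum>k\<in>{0..<int N}. \<Sum>R\<in>F. root_char N (k * (g R - z)))"
    by (rule sum.swap)
  also have "\<dots> = (\<Sum>k\<in>{0..<int N}. cnj (root_char N (k * z)) * (\<Sum>R\<in>F. root_char N (k * g R)))"
    by (simp add: right_diff_distrib root_char_diff sum_distrib_left mult.commute)
  finally have eq: "of_nat (N * card {R \<in> F. g R mod int N = z}) = \<dots>" .
  have "real N * real (card {R \<in> F. g R mod int N = z}) = cmod (of_nat (N * card {R \<in> F. g R mod int N = z}))"
    by (subst norm_of_nat) simp
  also have "\<dots> \<le> (\<Sum>k\<in>{0..<int N}. cmod (\<Sum>R\<in>F. root_char N (k * g R)))"
    unfolding eq by (rule order_trans[OF norm_sum]) (simp add: norm_mult)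
  also have "{0..<int N} = insert 0 {1..<int N}" using assms(1) by auto
  also have "(\<Sum>k\<in>\<dots>. cmod (\<Sum>R\<in>F. root_char N (k * g R))) =
     real (card F) + (\<Sum>k\<in>{1..<int N}. cmod (\<Sum>R\<in>F. root_char N (k * g R)))"
    by simp
  finally show ?thesis .
qed

section \<open>Coefficient extraction and bounds for the factors of the generating product\<close>

text \<open>A discrete Cauchy formula for the coefficient of X^m in the product of the factors
  \<open>p * X * c a + (1 - p)\<close>. The degree is at most \<open>card A\<close>, so
  \<open>card A + 1\<close> roots of unity isolate one coefficient without aliasing.\<close>

lemma elementary_symmetric_extract:
  fixes c :: "'a \<Rightarrow> complex" and p :: real
  assumes "finite A" "m \<le> card A"
  defines "M \<equiv> card A + 1"
  shows "of_nat M * (of_real (p ^ m * (1 - p) ^ (card A - m)) * (\<Sum>R | R \<subseteq> A \<and> card R = m. \<Prod>a\<in>R. c a))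
   = (\<Sum>j\<in>{0..<int M}. root_char M (- (j * int m)) * (\<Prod>a\<in>A. of_real p * root_char M j * c a + of_real (1 - p)))"
proof -
  define u where "u R = of_real (p ^ card R * (1 - p) ^ (card A - card R)) * (\<Prod>a\<in>R. c a)" for R
  have fin: "finite (Pow A)" using assms by simp
  have expand: "(\<Prod>a\<in>A. of_real p * root_char M j * c a + of_real (1 - p)) =
      (\<Sum>R\<in>Pow A. root_char M (j * int (card R)) * u R)" for j
  proof -
    have "(\<Prod>a\<in>A. of_real p * root_char M j * c a + of_real (1 - p)) =
       (\<Sum>R\<in>Pow A. (\<Prod>a\<in>R. of_real p * root_char M j * c a) * (\<Prod>a\<in>A-R. of_real (1 - p)))"
      using assms by (intro prod_add)
    also have "\<dots> = (\<Sum>R\<in>Pow A. root_char M (j * int (card R)) * u R)"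
    proof (rule sum.cong[OF refl])
      fix R assume "R \<in> Pow A"
      then have "card (A - R) = card A - card R" using assms(1)
        by (simp add: card_Diff_subset finite_subset)
      then show "(\<Prod>a\<in>R. of_real p * root_char M j * c a) * (\<Prod>a\<in>A-R. of_real (1 - p)) =
          root_char M (j * int (card R)) * u R"
        using root_char_of_nat_mult[of M "card R" j]
        by (simp add: u_def prod.distrib mult.commute mult.left_commute)
    qed
    finally show ?thesis .
  qed
  have shift: "root_char M (j * (int k - int m)) = root_char M (- (j * int m)) * root_char M (j * int k)" for j k
    by (simp add: root_char_add[symmetric] right_diff_distrib)
  have "(\<Sum>j\<in>{0..<int M}. root_char M (- (j * int m)) * (\<Prod>a\<in>A. of_real p * root_char M j * c a + of_real (1 - p)))
     = (\<Sum>j\<in>{0..<int M}. \<Sum>R\<in>Pow A. root_char M (j * (int (card R) - int m)) * u R)"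
    unfolding expand sum_distrib_left shift by (simp only: mult.assoc)
  also have "\<dots> = (\<Sum>R\<in>Pow A. (\<Sum>j\<in>{0..<int M}. root_char M (j * (int (card R) - int m))) * u R)"
    by (subst sum.swap) (simp add: sum_distrib_right)
  also have "\<dots> = (\<Sum>R\<in>Pow A. if card R = m then of_nat M * u R else 0)"
  proof (rule sum.cong[OF refl])
    fix R assume "R \<in> Pow A"
    then have "card R \<le> card A" using assms(1) by (simp add: card_mono)
    then have "int M dvd int (card R) - int m \<longleftrightarrow> card R = m"
      using assms(2) zdvd_imp_le[of "int M" "\<bar>int (card R) - int m\<bar>"] unfolding M_def by fastforce
    then show "(\<Sum>j\<in>{0..<int M}. root_char M (j * (int (card R) - int m))) * u R =
        (if card R = m then of_nat M * u R else 0)"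
      using sum_root_char[of M] by (simp add: M_def)
  qed
  also have "\<dots> = (\<Sum>R | R \<subseteq> A \<and> card R = m. of_nat M * u R)"
    using fin by (simp add: sum.inter_filter[symmetric] Pow_def)
  also have "\<dots> = of_nat M * (of_real (p ^ m * (1 - p) ^ (card A - m)) * (\<Sum>R | R \<subseteq> A \<and> card R = m. \<Prod>a\<in>R. c a))"
    by (simp add: u_def sum_distrib_left)
  finally show ?thesis by simp
qed

text \<open>The left side is the modulus of a Bernoulli characteristic function; its square is
  exactly 1 - 2 p (1 - p) (1 - cos \<alpha>).\<close>

lemma norm_convex_cis_le:
  assumes "0 \<le> p" "p \<le> 1"
  shows "cmod (of_real p * cis \<alpha> + of_real (1 - p)) \<le> exp (- (p * (1 - p) * (1 - cos \<alpha>)))"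
proof (rule power2_le_imp_le)
  have "cmod (of_real p * cis \<alpha> + of_real (1 - p)) ^ 2 = (p * cos \<alpha> + (1 - p))\<^sup>2 + (p * sin \<alpha>)\<^sup>2"
    by (simp add: cmod_power2)
  also have "\<dots> = 1 + - (2 * (p * (1 - p) * (1 - cos \<alpha>)))"
    using sin_cos_squared_add[of \<alpha>] by algebra
  also have "\<dots> \<le> exp (- (2 * (p * (1 - p) * (1 - cos \<alpha>))))"
    by (rule exp_ge_add_one_self)
  also have "\<dots> = exp (- (p * (1 - p) * (1 - cos \<alpha>))) ^ 2"
    by (simp add: exp_of_nat_mult[symmetric])
  finally show "cmod (of_real p * cis \<alpha> + of_real (1 - p)) ^ 2 \<le> exp (- (p * (1 - p) * (1 - cos \<alpha>))) ^ 2" .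
qed simp

text \<open>With S the sum of the \<open>cis (\<alpha> a)\<close>, the left side is n - |S|
  cos(\<theta> + Arg S). The bound separates two savings: one is uniform in the angle and measures
  how far |S| is below n, the other depends on the angle and survives even when |S| = n.\<close>

lemma sum_one_minus_cos_ge:
  fixes \<alpha> :: "'a \<Rightarrow> real"
  assumes "finite A"
  obtains \<theta>0 where "\<And>\<theta>. (\<Sum>a\<in>A. 1 - cos (\<theta> + \<alpha> a)) \<ge>
     (real (card A) - cmod (\<Sum>a\<in>A. cis (\<alpha> a))) / 4 + real (card A) * (1 - cos (\<theta> - \<theta>0)) / 8"
proof -
  define S where "S = (\<Sum>a\<in>A. cis (\<alpha> a))"
  have S: "cmod S \<le> real (card A)"
    unfolding S_def by (rule order_trans[OF norm_sum]) simp
  show ?thesis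
  proof (rule that[of "- Arg S"])
    fix \<theta>
    define x where "x = cos (\<theta> - (- Arg S))"
    have "cis \<theta> * S = of_real (cmod S) * cis (\<theta> + Arg S)"
      using rcis_cmod_Arg[of S] by (metis cis_mult mult.left_commute rcis_def)
    then have "Re (cis \<theta> * S) = cmod S * x" by (simp add: x_def)
    moreover have "(\<Sum>a\<in>A. 1 - cos (\<theta> + \<alpha> a)) = real (card A) - Re (cis \<theta> * S)"
      by (simp add: S_def sum_subtractf sum_distrib_left cis_mult)
    ultimately have eq: "(\<Sum>a\<in>A. 1 - cos (\<theta> + \<alpha> a)) = real (card A) - cmod S * x" by simp
    have x: "-1 \<le> x" "x \<le> 1" by (auto simp: x_def)
    \<comment> \<open>The claim is affine in |S|, so only the end points 0 and \<open>card A\<close>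
      matter; the split at 1/4 is the sign of the slope.\<close>
    have "cmod S * (x - 1/4) \<le> real (card A) * (5/8 + x/8)"
    proof (cases "x \<le> 1/4")
      case True
      then have "cmod S * (x - 1/4) \<le> 0" by (simp add: mult_nonneg_nonpos)
      also have "0 \<le> real (card A) * (5/8 + x/8)" using x by simp
      finally show ?thesis .
    next
      case False
      then have "cmod S * (x - 1/4) \<le> real (card A) * (x - 1/4)" using S by (intro mult_right_mono) auto
      also have "\<dots> \<le> real (card A) * (5/8 + x/8)" using x by (intro mult_left_mono) auto
      finally show ?thesis .
    qed
    then have "(real (card A) - cmod S) / 4 + real (card A) * (1 - x) / 8 \<le> real (card A) - cmod S * x"
      by (simp add: field_simps)
    then show "(\<Sum>a\<in>A. 1 - cos (\<theta> + \<alpha> a)) \<ge>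
     (real (card A) - cmod (\<Sum>a\<in>A. cis (\<alpha> a))) / 4 + real (card A) * (1 - cos (\<theta> - - Arg S)) / 8"
      unfolding eq S_def[symmetric] x_def[symmetric] .
  qed
qed

subsection \<open>Averages over roots of unity and the central binomial weight\<close>

lemma mult_cos_le_sin:
  fixes x :: real
  assumes "0 \<le> x" "x \<le> pi"
  shows "x * cos x \<le> sin x"
proof -
  have "(\<lambda>x. sin x - x * cos x) 0 \<le> (\<lambda>x. sin x - x * cos x) x"
  proof (rule DERIV_nonneg_imp_nondecreasing[OF assms(1)])
    fix t assume "0 \<le> t" "t \<le> x"
    then show "\<exists>y. ((\<lambda>x. sin x - x * cos x) has_real_derivative y) (at t) \<and> 0 \<le> y"
      using assms(2) by (intro exI[of _ "t * sin t"])
        (auto intro!: derivative_eq_intros mult_nonneg_nonneg sin_ge_zero simp: algebra_simps)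
  qed
  then show ?thesis by simp
qed

text \<open>At a quarter w of the angle the cosine is at least sqrt 2 / 2, so w cos w <= sin w gives
  sin(2w) >= w; doubling once more, 1 - cos u = 2 sin^2(2w).\<close>

lemma one_minus_cos_ge:
  fixes u :: real
  assumes "\<bar>u\<bar> \<le> pi"
  shows "1 - cos u \<ge> u\<^sup>2 / 8"
proof -
  define w where "w = \<bar>u\<bar> / 4"
  have w: "0 \<le> w" "w \<le> pi / 4" using assms by (auto simp: w_def)
  have c: "cos w \<ge> sqrt 2 / 2" using cos_monotone_0_pi_le[of w "pi/4"] w by (simp add: cos_45)
  have c0: "0 \<le> cos w" by (rule order_trans[OF _ c]) simp
  have "w \<le> 2 * (w * cos w * cos w)"
  proof -
    have "(sqrt 2 / 2) * (sqrt 2 / 2) \<le> cos w * cos w" using c c0 by (intro mult_mono) auto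
    then have "1/2 \<le> cos w * cos w" by simp
    then show ?thesis using mult_left_mono[OF _ w(1)] by (fastforce simp: mult.assoc)
  qed
  also have "\<dots> \<le> 2 * (sin w * cos w)"
    using mult_cos_le_sin[of w] w c0 by (intro mult_left_mono mult_right_mono) auto
  also have "\<dots> = sin (2 * w)" by (simp add: sin_double)
  finally have "w\<^sup>2 \<le> (sin (2 * w))\<^sup>2" using w by (intro power_mono)
  moreover have "1 - cos (2 * (2 * w)) = 2 * (sin (2 * w))\<^sup>2" by (simp only: cos_double_sin)
  moreover have "cos (2 * (2 * w)) = cos u" by (simp add: w_def)
  ultimately show ?thesis by (simp add: w_def power_divide)
qed

text \<open>A term of positive index is at most the increment of arctan(s x) / s over the unit
  interval to its left, so these terms telescope; index 0 accounts for the 1.\<close>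

lemma sum_inverse_one_plus_square_le:
  fixes s :: real
  assumes "s > 0" "finite L"
  shows "(\<Sum>l\<in>L. 1 / (1 + (s * real l)\<^sup>2)) \<le> 1 + pi / (2 * s)"
proof -
  have step: "1 / (1 + (s * real (Suc l))\<^sup>2) \<le> (arctan (s * real (Suc l)) - arctan (s * real l)) / s" for l
  proof -
    have "s * real l < s * real (Suc l)" using assms by simp
    then obtain z where z: "s * real l < z" "z < s * real (Suc l)"
      "arctan (s * real (Suc l)) - arctan (s * real l) = (s * real (Suc l) - s * real l) * inverse (1 + z\<^sup>2)"
      using MVT2[of "s * real l" "s * real (Suc l)" arctan "\<lambda>z. inverse (1 + z\<^sup>2)"] DERIV_arctan by blast
    have "0 \<le> z" using z(1) assms by (metis less_eq_real_def mult_nonneg_nonneg of_nat_0_le_iff order_trans)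
    then have "z\<^sup>2 \<le> (s * real (Suc l))\<^sup>2" using z(2) by (intro power_mono) auto
    then have "1 / (1 + (s * real (Suc l))\<^sup>2) \<le> inverse (1 + z\<^sup>2)"
      by (simp add: inverse_eq_divide frac_le add_pos_nonneg)
    also have "\<dots> = (arctan (s * real (Suc l)) - arctan (s * real l)) / s"
    proof -
      have "s * real (Suc l) - s * real l = s" by (simp add: algebra_simps)
      then show ?thesis using assms by (simp only: z(3)) simp
    qed
    finally show ?thesis .
  qed
  have part: "(\<Sum>l\<le>K. 1 / (1 + (s * real l)\<^sup>2)) \<le> 1 + arctan (s * real K) / s" for K
  proof (induction K)
    case (Suc K)
    then show ?case using step[of K] by (simp add: diff_divide_distrib)
  qed simp
  obtain K where K: "L \<subseteq> {..K}" using assms(2) finite_nat_iff_bounded_le by blast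
  have "(\<Sum>l\<in>L. 1 / (1 + (s * real l)\<^sup>2)) \<le> (\<Sum>l\<le>K. 1 / (1 + (s * real l)\<^sup>2))"
    using K by (intro sum_mono2) (auto intro: add_nonneg_nonneg)
  also have "\<dots> \<le> 1 + arctan (s * real K) / s" by (rule part)
  also have "\<dots> \<le> 1 + (pi / 2) / s"
    using arctan_ubound[of "s * real K"] assms by (intro add_left_mono divide_right_mono) auto
  finally show ?thesis by simp
qed

text \<open>Shifted by \<theta>0 and reduced modulo 2 pi, the angles are spaced and the terms decay
  like a Gaussian. The weaker majorant 1 / (1 + x^2) suffices and its sum is controlled by arctan.
  The condition \<open>sqrt b \<le> real M\<close> absorbs the terms nearest to the peak.\<close>

lemma sum_exp_one_minus_cos_le:
  fixes b \<theta>0 :: real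
  assumes "0 < b" "sqrt b \<le> real M" "M > 0"
  shows "(\<Sum>j\<in>{0..<int M}. exp (- (b * (1 - cos (2 * pi * of_int j / real M - \<theta>0))))) \<le> 4 * real M / sqrt b"
proof -
  \<comment> \<open>Chosen so that (s y)^2 = 4 b y^2 / M^2, which is at most b u^2 / 8 for u = 2 pi
    y / M because pi^2 / 2 >= 4.\<close>
  define s where "s = 2 * sqrt b / real M"
  have s: "s > 0" "s\<^sup>2 = 4 * b / (real M)\<^sup>2" using assms by (auto simp: s_def power_divide power_mult_distrib)
  define t where "t = \<theta>0 * real M / (2 * pi)"
  define r where "r j = round ((of_int j - t) / real M)" for j :: int
  define y where "y j = of_int j - t - real M * of_int (r j)" for j :: int
  define i where "i j = \<lfloor>y j\<rfloor>" for j
  \<comment> \<open>Numbers each side of the peak by naturals. When the floor of y is a negative x,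
    |y| is only known to exceed -x - 1, hence the shift.\<close>
  define w where "w x = (if x \<ge> 0 then nat x else nat (- x - 1))" for x :: int
  let ?J = "{0..<int M}"
  have ieq: "i j = j - int M * r j + \<lfloor>- t\<rfloor>" for j
  proof -
    have "y j = - t + of_int (j - int M * r j)" by (simp add: y_def)
    then show ?thesis unfolding i_def by (simp only: floor_add_int[symmetric])
  qed
  have inj: "inj_on i ?J"
  proof (rule inj_onI)
    fix j k assume jk: "j \<in> ?J" "k \<in> ?J" "i j = i k"
    then have "j - k = int M * (r j - r k)" by (simp add: ieq algebra_simps)
    then have "j mod int M = k mod int M" by (simp add: mod_eq_dvd_iff)
    then show "j = k" using jk by simp
  qed
  have bound: "exp (- (b * (1 - cos (2 * pi * of_int j / real M - \<theta>0)))) \<le> 1 / (1 + (s * real (w (i j)))\<^sup>2)" for j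
  proof -
    define u where "u = 2 * pi * y j / real M"
    have "u = 2 * pi * of_int j / real M - \<theta>0 - 2 * pi * of_int (r j)"
      using assms(3) by (simp add: u_def y_def t_def field_simps)
    then have cu: "cos (2 * pi * of_int j / real M - \<theta>0) = cos u"
      by (simp add: cos_diff cos_int_2pin sin_int_2pin del: mult.assoc)
    have "\<bar>(of_int j - t) / real M - of_int (r j)\<bar> \<le> 1/2"
      unfolding r_def using of_int_round_abs_le[of "(of_int j - t) / real M"] by (simp add: abs_minus_commute)
    then have "\<bar>y j / real M\<bar> \<le> 1/2" using assms(3) by (simp add: y_def field_simps)
    then have "\<bar>u\<bar> \<le> pi" unfolding u_def
      using mult_left_mono[of "\<bar>y j / real M\<bar>" "1/2" "2 * pi"] by (simp add: abs_mult)
    then have "u\<^sup>2 / 8 \<le> 1 - cos u" by (rule one_minus_cos_ge)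
    moreover have "4 * (y j)\<^sup>2 / (real M)\<^sup>2 \<le> u\<^sup>2 / 8"
    proof -
      have "2\<^sup>2 \<le> pi\<^sup>2 / 2 * 1" 
      proof -
        have "(3::real)\<^sup>2 \<le> pi\<^sup>2" using pi_gt3 by (intro power_mono) auto
        then show ?thesis by simp
      qed
      then have "2\<^sup>2 * ((y j)\<^sup>2 / (real M)\<^sup>2) \<le> pi\<^sup>2 / 2 * 1 * ((y j)\<^sup>2 / (real M)\<^sup>2)"
        by (intro mult_right_mono) auto
      then show ?thesis by (simp add: u_def power_mult_distrib power_divide)
    qed
    ultimately have "4 * (y j)\<^sup>2 / (real M)\<^sup>2 \<le> 1 - cos u" by linarith
    then have "b * (4 * (y j)\<^sup>2 / (real M)\<^sup>2) \<le> b * (1 - cos u)" using assms by (intro mult_left_mono) auto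
    then have le: "(s * y j)\<^sup>2 \<le> b * (1 - cos u)" using s(2) by (simp add: power_mult_distrib mult.commute)
    have "real (w (i j)) \<le> \<bar>y j\<bar>"
      unfolding w_def i_def by (auto simp: abs_if) linarith+
    then have "(s * real (w (i j)))\<^sup>2 \<le> (s * \<bar>y j\<bar>)\<^sup>2"
      using s by (intro power_mono mult_left_mono) auto
    also have "\<dots> = (s * y j)\<^sup>2" by (simp add: power_mult_distrib)
    finally have "1 + (s * real (w (i j)))\<^sup>2 \<le> 1 + b * (1 - cos u)" using le by simp
    also have "\<dots> \<le> exp (b * (1 - cos u))" by (rule exp_ge_add_one_self)
    finally have "1 + (s * real (w (i j)))\<^sup>2 \<le> exp (b * (1 - cos u))" .
    then show ?thesis unfolding cu exp_minus inverse_eq_divide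
      by (intro divide_left_mono mult_pos_pos) (auto intro: add_pos_nonneg)
  qed
  let ?f = "\<lambda>l. 1 / (1 + (s * real l)\<^sup>2)"
  let ?P = "{x \<in> i ` ?J. x \<ge> 0}" and ?Q = "{x \<in> i ` ?J. \<not> x \<ge> 0}"
  have fin: "finite ?P" "finite ?Q" by auto
  have "(\<Sum>j\<in>?J. exp (- (b * (1 - cos (2 * pi * of_int j / real M - \<theta>0))))) \<le> (\<Sum>j\<in>?J. ?f (w (i j)))"
    by (intro sum_mono bound)
  also have "\<dots> = (\<Sum>x\<in>i ` ?J. ?f (w x))" by (simp add: sum.reindex[OF inj])
  also have "i ` ?J = ?P \<union> ?Q" by blast
  also have "(\<Sum>x\<in>?P \<union> ?Q. ?f (w x)) = (\<Sum>x\<in>?P. ?f (w x)) + (\<Sum>x\<in>?Q. ?f (w x))"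
    using fin by (intro sum.union_disjoint) auto
  also have "(\<Sum>x\<in>?P. ?f (w x)) = (\<Sum>l\<in>w ` ?P. ?f l)"
    by (subst sum.reindex) (auto simp: inj_on_def w_def)
  also have "\<dots> \<le> 1 + pi / (2 * s)"
    using s fin by (intro sum_inverse_one_plus_square_le) auto
  also have "(\<Sum>x\<in>?Q. ?f (w x)) = (\<Sum>l\<in>w ` ?Q. ?f l)"
    by (subst sum.reindex) (auto simp: inj_on_def w_def)
  also have "\<dots> \<le> 1 + pi / (2 * s)"
    using s fin by (intro sum_inverse_one_plus_square_le) auto
  also have "1 + pi / (2 * s) + (1 + pi / (2 * s)) = 2 + pi * real M / (2 * sqrt b)"
    using assms by (simp add: s_def field_simps)
  also have "\<dots> \<le> 2 * (real M / sqrt b) + 2 * (real M / sqrt b)"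
  proof (intro add_mono)
    have "1 \<le> real M / sqrt b" using assms by (subst le_divide_eq_1_pos) auto
    then show "2 \<le> 2 * (real M / sqrt b)" by linarith
    show "pi * real M / (2 * sqrt b) \<le> 2 * (real M / sqrt b)"
      using pi_less_4 mult_right_mono[of "pi/2" 2 "real M / sqrt b"] assms by simp
  qed
  finally show ?thesis by simp
qed

section \<open>The binomial weight at its mode\<close>

lemma Suc_times_binomial_Suc: "Suc k * (n choose Suc k) = (n - k) * (n choose k)"
  using binomial_absorb_comp[of n k] binomial_absorption[of k n] by simp

lemma Bernstein_ratio:
  assumes "k < n"
  shows "real (Suc k) * (1 - x) * Bernstein n (Suc k) x = real (n - k) * x * Bernstein n k x"
proof -
  have "real (Suc k) * real (n choose Suc k) = real (n - k) * real (n choose k)"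
    using Suc_times_binomial_Suc[of k n] by (metis of_nat_mult)
  moreover have "(1 - x) ^ (n - k) = (1 - x) * (1 - x) ^ (n - Suc k)"
    using assms by (metis Suc_diff_Suc power_Suc)
  ultimately have "(real (Suc k) * real (n choose Suc k)) * (x * x ^ k * ((1 - x) * (1 - x) ^ (n - Suc k)))
      = (real (n - k) * real (n choose k)) * (x * x ^ k * (1 - x) ^ (n - k))"
    by (simp only:)
  then show ?thesis unfolding Bernstein_def power_Suc by (simp only: mult.assoc mult.commute mult.left_commute)
qed

text \<open>By \<open>Bernstein_ratio\<close> the weights rise or fall from k to k + 1 with the sign
  of (n - k) p - (k + 1) (1 - p). For p = m / n, n times this is n (m - k - 1) + m: nonnegative for
  k < m, and negative for k >= m because m < n.\<close>

lemma Bernstein_le_mode: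
  assumes "m < n" "k \<le> n"
  shows "Bernstein n k (real m / real n) \<le> Bernstein n m (real m / real n)"
proof -
  let ?p = "real m / real n"
  have p: "0 \<le> ?p" "?p < 1" using assms by auto
  have cmp: "real n * (real (n - k) * ?p) - real n * (real (Suc k) * (1 - ?p)) = real n * (real m - real k - 1) + real m"
    if "k < n" for k using that assms(1) by (simp add: of_nat_diff field_simps)
  have up: "Bernstein n k ?p \<le> Bernstein n (Suc k) ?p" if "k < m" for k
  proof -
    have nn: "0 \<le> real n * (real m - real k - 1) + real m" using that by simp
    have "real (Suc k) * (1 - ?p) \<le> real (n - k) * ?p"
    proof (rule mult_left_le_imp_le)
      have "k < n" using that assms(1) by simp
      then show "real n * (real (Suc k) * (1 - ?p)) \<le> real n * (real (n - k) * ?p)"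
        using nn unfolding cmp[symmetric, OF \<open>k < n\<close>] by (simp only: diff_ge_0_iff_ge)
    qed (use assms in simp)
    then have "real (Suc k) * (1 - ?p) * Bernstein n k ?p \<le> real (n - k) * ?p * Bernstein n k ?p"
      using p by (intro mult_right_mono Bernstein_nonneg) auto
    also have "\<dots> = real (Suc k) * (1 - ?p) * Bernstein n (Suc k) ?p"
      using Bernstein_ratio[of k n ?p] that assms by simp
    finally show ?thesis using p by (simp add: mult_le_cancel_left_pos)
  qed
  have down: "Bernstein n (Suc k) ?p \<le> Bernstein n k ?p" if "m \<le> k" "k < n" for k
  proof -
    have "real n * (real m - real k - 1) \<le> real n * (-1)" using that by (intro mult_left_mono) auto
    then have np: "real n * (real m - real k - 1) + real m \<le> 0" using assms(1) by simp
    have "real (n - k) * ?p \<le> real (Suc k) * (1 - ?p)"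
    proof (rule mult_left_le_imp_le)
      show "real n * (real (n - k) * ?p) \<le> real n * (real (Suc k) * (1 - ?p))"
        using np unfolding cmp[symmetric, OF \<open>k < n\<close>] by (simp only: diff_le_0_iff_le)
    qed (use assms in simp)
    then have "real (n - k) * ?p * Bernstein n k ?p \<le> real (Suc k) * (1 - ?p) * Bernstein n k ?p"
      using p by (intro mult_right_mono Bernstein_nonneg) auto
    then have "real (Suc k) * (1 - ?p) * Bernstein n (Suc k) ?p \<le> real (Suc k) * (1 - ?p) * Bernstein n k ?p"
      using Bernstein_ratio[of k n ?p] that by simp
    then show ?thesis using p by (simp add: mult_le_cancel_left_pos)
  qed
  show ?thesis
  proof (cases "k \<le> m")
    case True
    then show ?thesis
    proof (induction k rule: inc_induct)
      case (step k)
      then show ?case using up[of k] by linarith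
    qed simp
  next
    case False
    then have "m \<le> k" by simp
    then show ?thesis using assms(2)
    proof (induction k rule: dec_induct)
      case (step k)
      then show ?case using down[of k] by fastforce
    qed simp
  qed
qed

text \<open>Chebyshev: the variance is at most \<open>m\<close>, so mass 3/4 lies within 2 sqrt m of
  the mean. At most 5 sqrt m indices lie there and none outweighs the mode, whose weight is
  therefore at least 3 / (20 sqrt m).\<close>

lemma Bernstein_mode_ge:
  assumes "1 \<le> m" "m < n"
  shows "Bernstein n m (real m / real n) \<ge> 1 / (8 * sqrt (real m))"
proof -
  let ?p = "real m / real n"
  define b where "b k = Bernstein n k ?p" for k
  have p: "0 \<le> ?p" "?p \<le> 1" using assms by auto
  have b0: "0 \<le> b k" for k unfolding b_def using p by (rule Bernstein_nonneg)
  have sm: "1 \<le> sqrt (real m)" using assms by simp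
  have var: "(\<Sum>k\<le>n. (real k - real m)\<^sup>2 * b k) \<le> real m"
  proof -
    have "(\<Sum>k\<le>n. (real k - real m)\<^sup>2 * b k) = (\<Sum>k\<le>n. real k * (real k - 1) * b k)
        + (1 - 2 * real m) * (\<Sum>k\<le>n. real k * b k) + (real m)\<^sup>2 * (\<Sum>k\<le>n. b k)"
      by (simp add: sum_distrib_left sum.distrib[symmetric] algebra_simps power2_eq_square)
    also have "\<dots> = real n * (real n - 1) * ?p\<^sup>2 + (1 - 2 * real m) * (real n * ?p) + (real m)\<^sup>2"
      by (simp only: b_def sum_kk_Bernstein sum_k_Bernstein sum_Bernstein mult_1_right)
    also have "\<dots> = real m - real m * ?p"
      using assms by (simp add: field_simps power2_eq_square)
    also have "\<dots> \<le> real m" using p by simp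
    finally show ?thesis .
  qed
  define I where "I = {k. k \<le> n \<and> (real k - real m)\<^sup>2 \<le> 4 * real m}"
  have finI: "finite I" by (simp add: I_def)
  have cardI: "real (card I) \<le> 5 * sqrt (real m)"
  proof -
    define f where "f = \<lfloor>2 * sqrt (real m)\<rfloor>"
    have f: "0 \<le> f" "of_int f \<le> 2 * sqrt (real m)" using sm by (auto simp: f_def)
    have "int ` I \<subseteq> {int m - f..int m + f}"
    proof
      fix x assume "x \<in> int ` I"
      then obtain k where k: "x = int k" "(real k - real m)\<^sup>2 \<le> 4 * real m" by (auto simp: I_def)
      then have "\<bar>real k - real m\<bar> \<le> 2 * sqrt (real m)"
        using real_le_rsqrt[of "\<bar>real k - real m\<bar>" "4 * real m"] by (simp add: real_sqrt_mult)
      then have "of_int \<bar>int k - int m\<bar> \<le> 2 * sqrt (real m)" by simp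
      then have "\<bar>int k - int m\<bar> \<le> f" unfolding f_def by (simp only: le_floor_iff)
      then show "x \<in> {int m - f..int m + f}" using k by auto
    qed
    then have "card (int ` I) \<le> card {int m - f..int m + f}" by (intro card_mono) auto
    then have "int (card I) \<le> 2 * f + 1" using f by (simp add: card_image)
    then have "real (card I) \<le> 2 * of_int f + 1" by linarith
    then show ?thesis using f sm by linarith
  qed
  have "1 = (\<Sum>k\<le>n. b k)" by (simp add: b_def)
  also have "\<dots> \<le> (\<Sum>k\<le>n. (if k \<in> I then b m else 0) + (real k - real m)\<^sup>2 * b k / (4 * real m))"
  proof (rule sum_mono)
    fix k assume k: "k \<in> {..n}"
    show "b k \<le> (if k \<in> I then b m else 0) + (real k - real m)\<^sup>2 * b k / (4 * real m)"
    proof (cases "k \<in> I")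
      case True
      have "b k \<le> b m" unfolding b_def using k assms by (intro Bernstein_le_mode) auto
      moreover have "0 \<le> (real k - real m)\<^sup>2 * b k / (4 * real m)" using b0 by simp
      ultimately show ?thesis using True by simp
    next
      case False
      then have "4 * real m * b k \<le> (real k - real m)\<^sup>2 * b k"
        using k b0 by (intro mult_right_mono) (auto simp: I_def)
      then show ?thesis using False assms by (simp add: field_simps)
    qed
  qed
  also have "\<dots> = real (card I) * b m + (\<Sum>k\<le>n. (real k - real m)\<^sup>2 * b k) / (4 * real m)"
  proof -
    have "{..n} \<inter> I = I" by (auto simp: I_def)
    then show ?thesis by (simp add: sum.distrib sum.If_cases sum_divide_distrib)
  qed
  also have "\<dots> \<le> 5 * sqrt (real m) * b m + 1/4"
    using cardI var b0 assms by (intro add_mono mult_right_mono) (auto simp: field_simps)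
  finally have "3/4 \<le> 5 * sqrt (real m) * b m" by simp
  then show ?thesis using sm by (simp add: b_def field_simps)
qed

text \<open>The coefficient is extracted from the generating product with weights \<open>p = m / n\<close>, so that
  dividing by the binomial weight of the mode costs \<open>sqrt m\<close>; averaging the Gaussian factor in the
  angle gains \<open>sqrt m\<close> back.\<close>

lemma norm_elementary_symmetric_cis_le:
  fixes \<alpha> :: "'a \<Rightarrow> real"
  assumes "finite A" "1 \<le> m" "real m \<le> (1 - \<epsilon>) * real (card A)" "0 < \<epsilon>"
  shows "cmod (\<Sum>R | R \<subseteq> A \<and> card R = m. \<Prod>a\<in>R. cis (\<alpha> a))
    \<le> 96 / sqrt \<epsilon> * real (card A choose m) *
       exp (- (\<epsilon> / 4 * real m * (1 - cmod (\<Sum>a\<in>A. cis (\<alpha> a)) / real (card A))))"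
proof -
  define n where "n = card A"
  define M where "M = n + 1"
  define p where "p = real m / real n"
  define S where "S = (\<Sum>a\<in>A. cis (\<alpha> a))"
  define w where "w = p ^ m * (1 - p) ^ (n - m)"
  \<comment> \<open>The factor 1/8 of the angular saving times the lower bound \<epsilon> m for p (1
    - p) n.\<close>
  define b where "b = \<epsilon> * real m / 8"
  define X where "X = exp (- (\<epsilon> / 4 * real m * (1 - cmod S / real n)))"
  define e where "e = (\<Sum>R | R \<subseteq> A \<and> card R = m. \<Prod>a\<in>R. cis (\<alpha> a))"
  have n0: "n > 0" using assms by (cases "n = 0") (auto simp: n_def)
  have "\<epsilon> * real n > 0" using n0 assms by simp
  then have mn: "m < n" using assms(3) by (simp add: n_def[symmetric] algebra_simps)
  have p: "0 < p" "p < 1" using mn assms(2) by (auto simp: p_def)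
  have "p * real n \<le> (1 - \<epsilon>) * real n" using assms(3) n0 by (simp add: p_def n_def)
  then have q: "\<epsilon> \<le> 1 - p" using n0 by simp
  have Sn: "cmod S \<le> real n"
    unfolding S_def n_def by (rule order_trans[OF norm_sum]) simp
  have pqn: "\<epsilon> * real m \<le> p * (1 - p) * real n"
  proof -
    have "\<epsilon> * real m \<le> (1 - p) * real m" using q by (intro mult_right_mono) auto
    also have "\<dots> = p * (1 - p) * real n" using n0 by (simp add: p_def)
    finally show ?thesis .
  qed
  obtain \<theta>0 where \<theta>0: "\<And>\<theta>. (\<Sum>a\<in>A. 1 - cos (\<theta> + \<alpha> a)) \<ge>
     (real n - cmod S) / 4 + real n * (1 - cos (\<theta> - \<theta>0)) / 8"
    using sum_one_minus_cos_ge[OF assms(1)] unfolding n_def S_def by blast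
  have summand: "cmod (root_char M (- (j * int m)) * (\<Prod>a\<in>A. of_real p * root_char M j * cis (\<alpha> a) + of_real (1 - p)))
     \<le> X * exp (- (b * (1 - cos (2 * pi * of_int j / real M - \<theta>0))))" for j
  proof -
    define \<theta> where "\<theta> = 2 * pi * of_int j / real M"
    have "cmod (root_char M (- (j * int m)) * (\<Prod>a\<in>A. of_real p * root_char M j * cis (\<alpha> a) + of_real (1 - p)))
      = (\<Prod>a\<in>A. cmod (of_real p * cis (\<theta> + \<alpha> a) + of_real (1 - p)))"
      by (simp add: norm_mult prod_norm[symmetric] root_char_def[of M j] \<theta>_def cis_mult mult.assoc del: of_real_diff)
    also have "\<dots> \<le> (\<Prod>a\<in>A. exp (- (p * (1 - p) * (1 - cos (\<theta> + \<alpha> a)))))"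
      using p by (intro prod_mono conjI norm_convex_cis_le) auto
    also have "\<dots> = exp (- (p * (1 - p) * (\<Sum>a\<in>A. 1 - cos (\<theta> + \<alpha> a))))"
      using assms(1) by (simp add: exp_sum[symmetric] sum_negf sum_distrib_left)
    also have "\<dots> \<le> exp (- (\<epsilon> / 4 * real m * (1 - cmod S / real n)) + - (b * (1 - cos (\<theta> - \<theta>0))))"
    proof -
      define Y where "Y = (1 - cmod S / real n) / 4 + (1 - cos (\<theta> - \<theta>0)) / 8"
      have Y: "0 \<le> Y" using Sn n0 by (simp add: Y_def)
      have "real n * Y = (real n - cmod S) / 4 + real n * (1 - cos (\<theta> - \<theta>0)) / 8"
        using n0 by (simp add: Y_def field_simps)
      then have "real n * Y \<le> (\<Sum>a\<in>A. 1 - cos (\<theta> + \<alpha> a))" using \<theta>0[of \<theta>] by simp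
      then have "p * (1 - p) * (real n * Y) \<le> p * (1 - p) * (\<Sum>a\<in>A. 1 - cos (\<theta> + \<alpha> a))"
        using p by (intro mult_left_mono) auto
      moreover have "\<epsilon> * real m * Y \<le> p * (1 - p) * real n * Y"
        using pqn Y by (intro mult_right_mono)
      moreover have "\<epsilon> * real m * Y = \<epsilon> / 4 * real m * (1 - cmod S / real n) + b * (1 - cos (\<theta> - \<theta>0))"
        by (simp add: Y_def b_def algebra_simps)
      ultimately show ?thesis by (simp add: mult.assoc)
    qed
    also have "\<dots> = X * exp (- (b * (1 - cos (\<theta> - \<theta>0))))" unfolding X_def by (rule exp_add)
    finally show ?thesis by (simp only: \<theta>_def)
  qed
  have b: "0 < b" using assms by (simp add: b_def)
  have bM: "sqrt b \<le> real M"
  proof -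
    have "b \<le> 1 * real m" unfolding b_def using q p assms mult_right_mono[of \<epsilon> 1 "real m"] by simp
    also have "\<dots> \<le> real M" using mn by (simp add: M_def)
    also have "\<dots> \<le> (real M)\<^sup>2" by (rule self_le_power) (auto simp: M_def)
    finally show ?thesis by (intro real_le_lsqrt) auto
  qed
  have "real M * (w * cmod e) = cmod (of_nat M * (of_real w * e))"
  proof -
    have "0 \<le> w" using p by (simp add: w_def)
    then show ?thesis by (simp add: norm_mult)
  qed
  also have "of_nat M * (of_real w * e) =
      (\<Sum>j\<in>{0..<int M}. root_char M (- (j * int m)) * (\<Prod>a\<in>A. of_real p * root_char M j * cis (\<alpha> a) + of_real (1 - p)))"
    unfolding w_def e_def M_def n_def by (rule elementary_symmetric_extract) (use assms(1) mn n_def in auto)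
  also have "cmod \<dots> \<le> (\<Sum>j\<in>{0..<int M}. X * exp (- (b * (1 - cos (2 * pi * of_int j / real M - \<theta>0)))))"
    by (rule order_trans[OF norm_sum]) (intro sum_mono summand)
  also have "\<dots> \<le> X * (4 * real M / sqrt b)"
    unfolding sum_distrib_left[symmetric] using b bM
    by (intro mult_left_mono sum_exp_one_minus_cos_le) (auto simp: X_def M_def)
  finally have "real M * (w * cmod e) \<le> real M * (4 * X / sqrt b)" by (simp add: mult_ac)
  then have we: "w * cmod e \<le> 4 * X / sqrt b"
    by (rule mult_left_le_imp_le) (simp add: M_def)
  define K where "K = real (n choose m)"
  have K: "K > 0" using mn by (simp add: K_def)
  have "1 / (8 * sqrt (real m)) \<le> K * w"
    using Bernstein_mode_ge[OF assms(2) mn] by (simp add: Bernstein_def K_def w_def p_def)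
  then have "1 / (8 * sqrt (real m)) * cmod e \<le> K * w * cmod e" by (rule mult_right_mono) simp
  also have "\<dots> \<le> K * (4 * X / sqrt b)" unfolding mult.assoc using we K by (intro mult_left_mono) auto
  finally have "cmod e \<le> K * (4 * X / sqrt b) * (8 * sqrt (real m))"
    using assms(2) by (simp add: field_simps)
  \<comment> \<open>The factor 4 comes from the average over the angle, 8 from the weight of the
    mode, sqrt 8 from \<open>b\<close>; 96 rounds 32 sqrt 8 up.\<close>
  also have "\<dots> = 32 * sqrt 8 / sqrt \<epsilon> * (K * X)"
    using assms by (simp add: b_def real_sqrt_mult real_sqrt_divide)
  also have "\<dots> \<le> 96 / sqrt \<epsilon> * (K * X)"
  proof (intro mult_right_mono divide_right_mono)
    show "32 * sqrt 8 \<le> (96::real)" using real_sqrt_le_mono[of 8 9] by simp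
  qed (use K assms in \<open>auto simp: X_def\<close>)
  finally show ?thesis by (simp add: e_def K_def X_def n_def S_def mult.assoc)
qed

text \<open>Layer l holds the k with l <= x k sqrt m < l + 1; by \<open>count\<close> it has at most
  Q (l + 1) / sqrt m elements. Since l <= l^2, the Gaussian there is at most r^l with r = exp(-c),
  and the sum of (l + 1) r^l is 1 / (1 - r)^2.\<close>

lemma sum_exp_square_le_of_linear_count:
  fixes x :: "'a \<Rightarrow> real"
  assumes "finite D" "\<And>k. k \<in> D \<Longrightarrow> 0 \<le> x k" "0 < c" "1 \<le> m" "0 \<le> Q"
    and count: "\<And>s. 0 < s \<Longrightarrow> real (card {k \<in> D. x k \<le> s}) \<le> Q * s"
  shows "(\<Sum>k\<in>D. exp (- (c * real m * (x k)\<^sup>2))) \<le> Q / sqrt (real m) / (1 - exp (- c))\<^sup>2"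
proof -
  define r where "r = sqrt (real m)"
  define \<rho> where "\<rho> = exp (- c)"
  define i where "i k = nat \<lfloor>x k * r\<rfloor>" for k
  have r: "1 \<le> r" "r\<^sup>2 = real m" using assms by (auto simp: r_def)
  have \<rho>: "0 < \<rho>" "\<rho> < 1" using assms by (auto simp: \<rho>_def)
  have i: "real (i k) \<le> x k * r" "x k * r \<le> real (Suc (i k))" if "k \<in> D" for k
  proof -
    have "0 \<le> x k * r" using assms(2)[OF that] r by simp
    then show "real (i k) \<le> x k * r" "x k * r \<le> real (Suc (i k))" unfolding i_def by linarith+
  qed
  have le: "exp (- (c * real m * (x k)\<^sup>2)) \<le> \<rho> ^ i k" if "k \<in> D" for k
  proof -
    have "real (i k) \<le> (real (i k))\<^sup>2" by (cases "i k = 0") (auto intro: self_le_power)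
    also have "\<dots> \<le> (x k * r)\<^sup>2" using i[OF that] by (intro power_mono) auto
    also have "\<dots> = real m * (x k)\<^sup>2" using r by (simp add: power_mult_distrib)
    finally have "c * real (i k) \<le> c * (real m * (x k)\<^sup>2)" using assms by (intro mult_left_mono) auto
    then show ?thesis by (simp add: \<rho>_def exp_of_nat_mult[symmetric] mult.assoc mult.commute)
  qed
  have "(\<Sum>k\<in>D. exp (- (c * real m * (x k)\<^sup>2))) \<le> (\<Sum>k\<in>D. \<rho> ^ i k)"
    by (intro sum_mono le)
  also have "\<dots> = (\<Sum>l\<in>i ` D. \<Sum>k | k \<in> D \<and> i k = l. \<rho> ^ i k)"
    using assms(1) by (rule sum.image_gen)
  also have "\<dots> = (\<Sum>l\<in>i ` D. real (card {k \<in> D. i k = l}) * \<rho> ^ l)"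
    by (intro sum.cong) auto
  also have "\<dots> \<le> (\<Sum>l\<in>i ` D. Q / r * (real (Suc l) * \<rho> ^ l))"
  proof (rule sum_mono)
    fix l
    have "card {k \<in> D. i k = l} \<le> card {k \<in> D. x k \<le> real (Suc l) / r}"
      using assms(1) i r by (intro card_mono) (auto simp: field_simps)
    then have "real (card {k \<in> D. i k = l}) \<le> Q * (real (Suc l) / r)"
      using count[of "real (Suc l) / r"] r by simp
    then have "real (card {k \<in> D. i k = l}) * \<rho> ^ l \<le> Q * (real (Suc l) / r) * \<rho> ^ l"
      using \<rho> by (intro mult_right_mono) auto
    then show "real (card {k \<in> D. i k = l}) * \<rho> ^ l \<le> Q / r * (real (Suc l) * \<rho> ^ l)" by simp
  qed
  also have "\<dots> \<le> Q / r * (1 / (1 - \<rho>)\<^sup>2)"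
    unfolding sum_distrib_left[symmetric]
  proof (intro mult_left_mono)
    have "(\<lambda>n. real (Suc n) * \<rho> ^ n) sums (1 / (1 - \<rho>)\<^sup>2)"
      using geometric_deriv_sums[of \<rho>] \<rho> by simp
    then show "(\<Sum>l\<in>i ` D. real (Suc l) * \<rho> ^ l) \<le> 1 / (1 - \<rho>)\<^sup>2"
      using sum_le_suminf[of "\<lambda>n. real (Suc n) * \<rho> ^ n" "i ` D"] assms(1) \<rho>
      by (simp add: sums_iff)
  qed (use assms r in auto)
  finally show ?thesis by (simp add: r_def \<rho>_def)
qed

subsection \<open>Level sets of the exponential sum\<close>

lemma root_char_mod_mult: "root_char N ((k mod int N) * x) = root_char N (k * x)"
proof (cases "N = 0")
  case False
  have "k mod int N * x = k * x - int N * (k div int N * x)"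
    by (simp add: minus_div_mult_eq_mod[symmetric] algebra_simps)
  moreover have "root_char N (int N * (k div int N * x)) = 1"
    using root_char_eq_1_iff[of N] False by simp
  ultimately show ?thesis by (simp add: root_char_diff)
qed simp

definition exp_sum :: "nat \<Rightarrow> int set \<Rightarrow> int \<Rightarrow> complex" where
  "exp_sum N A k = (\<Sum>a\<in>A. root_char N (k * a))"

text \<open>Writing the gap between \<open>card A\<close> and the size of the exponential sum as an \<open>L2\<close> norm
  makes it subadditive in the frequency, so that sumsets of level sets stay in level sets.\<close>

definition defect :: "nat \<Rightarrow> int set \<Rightarrow> int \<Rightarrow> real" where
  "defect N A k = L2_set (\<lambda>(a, b). \<bar>sin (pi * of_int (k * (a - b)) / real N)\<bar>) (A \<times> A)"

lemma defect_nonneg [simp]: "0 \<le> defect N A k"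
  by (simp add: defect_def)

lemma exp_sum_square:
  "of_real ((cmod (exp_sum N A k))\<^sup>2) = (\<Sum>(a, b)\<in>A \<times> A. root_char N (k * (a - b)))"
proof -
  have "of_real ((cmod (exp_sum N A k))\<^sup>2) = exp_sum N A k * cnj (exp_sum N A k)"
    by (rule complex_norm_square)
  also have "\<dots> = (\<Sum>(a, b)\<in>A \<times> A. root_char N (k * (a - b)))"
    by (simp add: exp_sum_def sum_product sum.cartesian_product right_diff_distrib root_char_diff)
  finally show ?thesis .
qed

text \<open>This is 1 - cos 2x = 2 sin^2 x summed over pairs. The L2 form yields subadditivity, the
  exponential sum gives access to Parseval and to the Fourier coefficients.\<close>

lemma defect_square:
  "(defect N A k)\<^sup>2 = ((real (card A))\<^sup>2 - (cmod (exp_sum N A k))\<^sup>2) / 2"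
proof -
  have c: "Re (root_char N x) = 1 - 2 * \<bar>sin (pi * of_int x / real N)\<bar>\<^sup>2" for x
  proof -
    have "Re (root_char N x) = cos (2 * (pi * of_int x / real N))" by (simp add: root_char_def mult.assoc)
    then show ?thesis by (simp only: cos_double_sin power2_abs)
  qed
  have "(cmod (exp_sum N A k))\<^sup>2 = Re (\<Sum>(a, b)\<in>A \<times> A. root_char N (k * (a - b)))"
    by (metis Re_complex_of_real exp_sum_square)
  also have "\<dots> = (\<Sum>(a, b)\<in>A \<times> A. 1 - 2 * \<bar>sin (pi * of_int (k * (a - b)) / real N)\<bar>\<^sup>2)"
    by (simp add: c split_def)
  also have "\<dots> = (real (card A))\<^sup>2 - 2 * (defect N A k)\<^sup>2"
    by (simp add: defect_def L2_set_def split_def sum_subtractf sum_distrib_left[symmetric] sum_nonneg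
        card_cartesian_product power2_eq_square[of "real (card A)"] real_sqrt_pow2)
  finally show ?thesis by simp
qed

lemma defect_cong: "cmod (exp_sum N A k) = cmod (exp_sum N A l) \<Longrightarrow> defect N A k = defect N A l"
  by (rule power2_eq_imp_eq) (simp_all add: defect_square)

lemma defect_mod [simp]: "defect N A (k mod int N) = defect N A k"
  by (rule defect_cong) (simp add: exp_sum_def root_char_mod_mult)

lemma defect_uminus [simp]: "defect N A (- k) = defect N A k"
  by (simp add: defect_def)

lemma defect_0 [simp]: "defect N A 0 = 0"
  by (simp add: defect_def split_def L2_set_0')

text \<open>For each pair |sin(x + y)| <= |sin x| + |sin y|; Minkowski's inequality does the
  rest.\<close>

lemma defect_add_le: "defect N A (k + l) \<le> defect N A k + defect N A l"
proof -
  let ?s = "\<lambda>k p. \<bar>sin (pi * of_int (k * (fst p - snd p)) / real N)\<bar>"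
  have "?s (k + l) p \<le> ?s k p + ?s l p" for p
  proof -
    define x y where "x = pi * of_int (k * (fst p - snd p)) / real N" and "y = pi * of_int (l * (fst p - snd p)) / real N"
    have "\<bar>sin (x + y)\<bar> \<le> \<bar>sin x * cos y\<bar> + \<bar>cos x * sin y\<bar>" unfolding sin_add by (rule abs_triangle_ineq)
    also have "\<dots> \<le> \<bar>sin x\<bar> + \<bar>sin y\<bar>"
      unfolding abs_mult by (intro add_mono mult_left_le mult_left_le_one_le) auto
    finally show ?thesis by (simp add: x_def y_def distrib_right distrib_left add_divide_distrib)
  qed
  then have "defect N A (k + l) \<le> L2_set (\<lambda>p. ?s k p + ?s l p) (A \<times> A)"
    unfolding defect_def split_def by (intro L2_set_mono) auto
  also have "\<dots> \<le> defect N A k + defect N A l"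
    unfolding defect_def split_def by (rule L2_set_triangle_ineq)
  finally show ?thesis .
qed

lemma parseval_exp_sum:
  assumes "N > 0" "A \<subseteq> {0..<int N}"
  shows "(\<Sum>k\<in>{0..<int N}. (cmod (exp_sum N A k))\<^sup>2) = real N * real (card A)"
proof -
  have fin: "finite A" using assms(2) finite_subset by blast
  have "complex_of_real (\<Sum>k\<in>{0..<int N}. (cmod (exp_sum N A k))\<^sup>2)
     = (\<Sum>p\<in>A \<times> A. \<Sum>k\<in>{0..<int N}. root_char N (k * (fst p - snd p)))"
    by (simp only: of_real_sum exp_sum_square split_def) (rule sum.swap)
  also have "\<dots> = (\<Sum>p\<in>A \<times> A. if snd p = fst p then of_nat N else 0)"
  proof (rule sum.cong[OF refl])
    fix p assume "p \<in> A \<times> A"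
    then have "fst p \<in> {0..<int N}" "snd p \<in> {0..<int N}" using assms(2) by auto
    then have "int N dvd fst p - snd p \<longleftrightarrow> snd p = fst p"
      by (metis atLeastLessThan_iff mod_eq_dvd_iff mod_pos_pos_trivial)
    then show "(\<Sum>k\<in>{0..<int N}. root_char N (k * (fst p - snd p))) = (if snd p = fst p then of_nat N else 0)"
      using sum_root_char[OF assms(1)] by simp
  qed
  also have "\<dots> = (\<Sum>a\<in>A. \<Sum>b\<in>A. if b = a then of_nat N else 0)"
    by (simp add: sum.cartesian_product split_def)
  also have "\<dots> = complex_of_real (real N * real (card A))"
    using fin by (simp add: mult.commute)
  finally show ?thesis by (simp only: of_real_eq_iff)
qed

definition level :: "nat \<Rightarrow> int set \<Rightarrow> real \<Rightarrow> int set" where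
  "level N A s = {k \<in> {0..<int N}. defect N A k \<le> s * real (card A)}"

lemma finite_level [simp]: "finite (level N A s)"
  by (rule finite_subset[of _ "{0..<int N}"]) (auto simp: level_def)

text \<open>For \<open>s \<le> 1/2\<close> the squared modulus n^2 - 2 defect^2 of the exponential
  sum is at least n^2 / 2 on the level set, while by Parseval all squares add up to N n.\<close>

lemma card_level_le:
  assumes "N > 0" "A \<subseteq> {0..<int N}" "A \<noteq> {}" "0 \<le> s" "s \<le> 1/2"
  shows "real (card (level N A s)) \<le> 2 * real N / real (card A)"
proof -
  have n: "card A > 0" using assms finite_subset[OF assms(2)] by (simp add: card_gt_0_iff)
  have "real (card (level N A s)) * ((real (card A))\<^sup>2 / 2) = (\<Sum>k\<in>level N A s. (real (card A))\<^sup>2 / 2)"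
    by simp
  also have "\<dots> \<le> (\<Sum>k\<in>level N A s. (cmod (exp_sum N A k))\<^sup>2)"
  proof (rule sum_mono)
    fix k assume "k \<in> level N A s"
    then have "(defect N A k)\<^sup>2 \<le> (s * real (card A))\<^sup>2" by (intro power_mono) (auto simp: level_def)
    also have "\<dots> \<le> (1/2 * real (card A))\<^sup>2" using assms by (intro power_mono mult_right_mono) auto
    finally show "(real (card A))\<^sup>2 / 2 \<le> (cmod (exp_sum N A k))\<^sup>2"
      by (simp add: defect_square power_mult_distrib power_divide)
  qed
  also have "\<dots> \<le> (\<Sum>k\<in>{0..<int N}. (cmod (exp_sum N A k))\<^sup>2)"
    by (intro sum_mono2) (auto simp: level_def)
  also have "\<dots> = real N * real (card A)" by (rule parseval_exp_sum[OF assms(1,2)])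
  finally show ?thesis using n by (simp add: field_simps power2_eq_square)
qed

text \<open>The average of a character over a subgroup \<open>K\<close> is \<open>0\<close> or \<open>1\<close>, so small defect on \<open>K\<close> means that
  most differences of \<open>A\<close> lie in the annihilator of \<open>K\<close>.\<close>

lemma concentrated_of_subgroup_in_level:
  assumes "N > 0" "A \<subseteq> {0..<int N}" "A \<noteq> {}" "0 \<le> s"
    and K: "subgroup K (integer_mod_group N)" "K \<noteq> {0}" "K \<subseteq> level N A s"
  obtains H a where "subgroup H (integer_mod_group N)" "H \<noteq> carrier (integer_mod_group N)"
    "a \<in> carrier (integer_mod_group N)"
    "real (card (A \<inter> (a <#\<^bsub>integer_mod_group N\<^esub> H))) \<ge> (1 - 2 * s\<^sup>2) * real (card A)"
proof -
  let ?G = "integer_mod_group N"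
  have car: "carrier ?G = {0..<int N}" using assms(1) by (simp add: carrier_integer_mod_group)
  define P where "P x \<longleftrightarrow> (\<forall>k\<in>K. int N dvd k * x)" for x
  define H where "H = {x \<in> {0..<int N}. P x}"
  have Ksub: "K \<subseteq> {0..<int N}" using K(1) car by (metis subgroup.subset)
  have finK: "finite K" and finA: "finite A" using Ksub assms(2) finite_subset by blast+
  have K0: "0 \<in> K" using subgroup.one_closed[OF K(1)] by simp
  have cK: "card K > 0" using K0 finK by (auto simp: card_gt_0_iff)
  have n: "card A > 0" using assms(3) finA by (simp add: card_gt_0_iff)
  obtain k0 where k0: "k0 \<in> K" "k0 \<noteq> 0" using K(2) K0 by blast
  have Pmod: "P (x mod int N) \<longleftrightarrow> P x" for x
    unfolding P_def by (simp add: dvd_eq_mod_eq_0 mod_mult_right_eq)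
  have sH: "subgroup H ?G"
  proof (rule group.subgroupI[OF group_integer_mod_group])
    show "H \<subseteq> carrier ?G" by (auto simp: H_def car)
    show "H \<noteq> {}" using assms(1) by (auto simp: H_def P_def intro!: exI[of _ 0])
    show "inv\<^bsub>?G\<^esub> x \<in> H" if "x \<in> H" for x
      using that assms(1) Pmod[of "- x"] by (auto simp: H_def car) (auto simp: P_def)
    show "x \<otimes>\<^bsub>?G\<^esub> y \<in> H" if "x \<in> H" "y \<in> H" for x y
      using that assms(1) Pmod[of "x + y"] by (auto simp: H_def) (auto simp: P_def distrib_left)
  qed
  \<comment> \<open>1 is not in the annihilator, since N does not divide \<open>k0\<close>.\<close>
  have Hne: "H \<noteq> carrier ?G"
  proof
    assume "H = carrier ?G"
    moreover have "k0 \<in> {0..<int N}" using k0 Ksub by blast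
    ultimately have "1 \<in> H" using k0 car by auto
    then have "int N dvd k0" using k0 by (auto simp: H_def P_def)
    then show False using \<open>k0 \<in> {0..<int N}\<close> k0(2) zdvd_imp_le by fastforce
  qed
  have avg: "(\<Sum>k\<in>K. root_char N (k * x)) = (if P x then of_nat (card K) else 0)" for x
  proof (cases "P x")
    case True
    then have "root_char N (k * x) = 1" if "k \<in> K" for k
      using root_char_eq_1_iff[OF assms(1)] that by (simp add: P_def)
    then show ?thesis using True by simp
  next
    case False
    then obtain l where l: "l \<in> K" "\<not> int N dvd l * x" by (auto simp: P_def)
    have lN: "l \<in> {0..<int N}" using l Ksub by blast
    \<comment> \<open>Translation by \<open>l\<close> permutes \<open>K\<close> and multiplies the
      sum by \<open>root_char N (l * x)\<close>, which is not 1; so the sum vanishes.\<close>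
    have inj: "inj_on (\<lambda>k. (k + l) mod int N) K"
    proof (rule inj_onI)
      fix k k' assume kk: "k \<in> K" "k' \<in> K" "(k + l) mod int N = (k' + l) mod int N"
      then have "int N dvd k - k'" by (simp add: mod_eq_dvd_iff)
      then have "k mod int N = k' mod int N" by (simp add: mod_eq_dvd_iff)
      moreover have "k \<in> {0..<int N}" "k' \<in> {0..<int N}" using kk Ksub by auto
      ultimately show "k = k'" by simp
    qed
    have img: "(\<lambda>k. (k + l) mod int N) ` K = K"
      using subgroup.m_closed[OF K(1) _ l(1)] finK inj
      by (intro endo_inj_surj) auto
    have "(\<Sum>k\<in>K. root_char N (k * x)) = (\<Sum>k\<in>(\<lambda>k. (k + l) mod int N) ` K. root_char N (k * x))"
      by (simp only: img)
    also have "\<dots> = (\<Sum>k\<in>K. root_char N ((k + l) * x))"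
      by (simp add: sum.reindex[OF inj] root_char_mod_mult)
    also have "\<dots> = root_char N (l * x) * (\<Sum>k\<in>K. root_char N (k * x))"
      unfolding distrib_right root_char_add sum_distrib_left by (simp only: mult.commute)
    finally have "(\<Sum>k\<in>K. root_char N (k * x)) * (1 - root_char N (l * x)) = 0" by (simp add: algebra_simps)
    then show ?thesis using False l(2) root_char_eq_1_iff[OF assms(1)] by auto
  qed
  define E where "E = {p \<in> A \<times> A. P (fst p - snd p)}"
  have "complex_of_real (\<Sum>k\<in>K. (cmod (exp_sum N A k))\<^sup>2)
     = (\<Sum>p\<in>A \<times> A. \<Sum>k\<in>K. root_char N (k * (fst p - snd p)))"
    by (simp only: of_real_sum exp_sum_square split_def) (rule sum.swap)
  also have "\<dots> = complex_of_real (real (card K) * real (card E))"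
    using finA by (simp add: avg sum.If_cases E_def Int_def mult.commute)
  finally have sumK: "(\<Sum>k\<in>K. (cmod (exp_sum N A k))\<^sup>2) = real (card K) * real (card E)"
    by (simp only: of_real_eq_iff)
  have "real (card K) * ((1 - 2 * s\<^sup>2) * (real (card A))\<^sup>2) = (\<Sum>k\<in>K. (1 - 2 * s\<^sup>2) * (real (card A))\<^sup>2)"
    by simp
  also have "\<dots> \<le> (\<Sum>k\<in>K. (cmod (exp_sum N A k))\<^sup>2)"
  proof (rule sum_mono)
    fix k assume "k \<in> K"
    then have "(defect N A k)\<^sup>2 \<le> (s * real (card A))\<^sup>2" using K(3) by (intro power_mono) (auto simp: level_def)
    then show "(1 - 2 * s\<^sup>2) * (real (card A))\<^sup>2 \<le> (cmod (exp_sum N A k))\<^sup>2"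
      by (simp add: defect_square power_mult_distrib algebra_simps)
  qed
  also have "\<dots> = real (card K) * real (card E)" by (rule sumK)
  finally have cE: "(1 - 2 * s\<^sup>2) * (real (card A))\<^sup>2 \<le> real (card E)" using cK by simp
  \<comment> \<open>\<open>E\<close> fills a proportion of at least 1 - 2 s^2 of A x A, so some
    \<open>b\<close> in \<open>A\<close> has at least that proportion of \<open>A\<close> as
    partners.\<close>
  define f where "f b = card {a \<in> A. P (a - b)}" for b
  have cEf: "card E = (\<Sum>b\<in>A. f b)"
  proof -
    have "card E = card (SIGMA b:A. {a \<in> A. P (a - b)})"
      by (rule bij_betw_same_card[of prod.swap]) (auto simp: E_def bij_betw_def inj_on_def image_def)
    then show ?thesis using finA by (simp add: f_def)
  qed
  have "\<exists>b\<in>A. (1 - 2 * s\<^sup>2) * real (card A) \<le> real (f b)"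
  proof (rule ccontr)
    assume "\<not> ?thesis"
    then have "(\<Sum>b\<in>A. real (f b)) < (\<Sum>b\<in>A. (1 - 2 * s\<^sup>2) * real (card A))"
      using finA assms(3) by (intro sum_strict_mono) auto
    then show False using cE cEf by (simp add: power2_eq_square mult.left_commute)
  qed
  then obtain b where b: "b \<in> A" "(1 - 2 * s\<^sup>2) * real (card A) \<le> real (f b)" by blast
  have "{a \<in> A. P (a - b)} \<subseteq> A \<inter> (b <#\<^bsub>?G\<^esub> H)"
  proof safe
    fix a assume a: "a \<in> A" "P (a - b)"
    have "(a - b) mod int N \<in> H" using a Pmod assms(1) by (simp add: H_def)
    moreover have "a = (b + (a - b) mod int N) mod int N"
      using a assms(2) by (auto simp: mod_add_right_eq)
    ultimately show "a \<in> b <#\<^bsub>?G\<^esub> H" by (auto simp: l_coset_def)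
  qed
  then have "f b \<le> card (A \<inter> (b <#\<^bsub>?G\<^esub> H))"
    unfolding f_def using finA by (intro card_mono) auto
  then have "(1 - 2 * s\<^sup>2) * real (card A) \<le> real (card (A \<inter> (b <#\<^bsub>?G\<^esub> H)))" using b by linarith
  then show ?thesis using that[OF sH Hne] b assms(2) car by blast
qed

lemma iterated_level_subset:
  assumes "N > 0" "0 \<le> s"
  shows "((\<lambda>X. X <#>\<^bsub>integer_mod_group N\<^esub> level N A s) ^^ j) {\<one>\<^bsub>integer_mod_group N\<^esub>} \<subseteq> level N A (real j * s)"
proof (induction j)
  case 0
  show ?case using assms by (simp add: level_def)
next
  case (Suc j)
  have "(x + y) mod int N \<in> level N A (real (Suc j) * s)"
    if "x \<in> level N A (real j * s)" "y \<in> level N A s" for x y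
  proof -
    have "defect N A (x + y) \<le> defect N A x + defect N A y" by (rule defect_add_le)
    also have "\<dots> \<le> real j * s * real (card A) + s * real (card A)"
      using that by (intro add_mono) (auto simp: level_def)
    finally show ?thesis using assms by (simp add: level_def algebra_simps)
  qed
  then show ?case using Suc by (auto simp: set_mult_def)
qed

text \<open>For j = floor(s0 / s) >= s0 / (2 s) the j-fold sumset stays in the level set of
  \<open>s0\<close>, which has at most 2N/n elements; growth turns this into j |level s| <= 4N/n.
  Frequency 0 lies in every level set, so a bound linear in \<open>s\<close> can hold for small
  \<open>s\<close> only after its removal.\<close>

lemma card_level_growth:
  assumes "N > 0" "A \<subseteq> {0..<int N}" "A \<noteq> {}" "0 < s0" "s0 \<le> 1/2" "0 < s" "s \<le> s0"
    and nosub: "\<And>K. subgroup K (integer_mod_group N) \<Longrightarrow> K \<subseteq> level N A s0 \<Longrightarrow> K = {0}"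
  shows "real (card (level N A s - {0})) \<le> 8 * real N * s / (real (card A) * s0)"
proof (cases "level N A s = {0}")
  case True
  then show ?thesis using assms by simp
next
  case False
  let ?G = "integer_mod_group N"
  have car: "carrier ?G = {0..<int N}" using assms(1) by (simp add: carrier_integer_mod_group)
  interpret comm_group ?G by simp
  have n: "card A > 0" using assms finite_subset[OF assms(2)] by (simp add: card_gt_0_iff)
  define j where "j = nat \<lfloor>s0 / s\<rfloor>"
  have one: "1 \<le> s0 / s" using assms by simp
  have j: "real j \<le> s0 / s" "s0 / s \<le> real j + 1" "1 \<le> j" 
    using one unfolding j_def by linarith+
  have js: "real j * s \<le> s0" using j(1) assms by (simp add: field_simps)
  have sub: "((\<lambda>X. X <#>\<^bsub>?G\<^esub> level N A s) ^^ j) {\<one>\<^bsub>?G\<^esub>} \<subseteq> level N A s0"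
  proof -
    have "level N A (real j * s) \<subseteq> level N A s0"
      using mult_right_mono[OF js, of "real (card A)"] by (auto simp: level_def)
    then show ?thesis using iterated_level_subset[OF assms(1), where s = s and A = A and j = j] assms by auto
  qed
  have "j * card (level N A s) \<le> 2 * card (((\<lambda>X. X <#>\<^bsub>?G\<^esub> level N A s) ^^ j) {\<one>\<^bsub>?G\<^esub>})"
  proof (rule card_iterated_set_mult_ge)
    show "finite (carrier ?G)" "level N A s \<subseteq> carrier ?G" by (auto simp: car level_def)
    show "\<one>\<^bsub>?G\<^esub> \<in> level N A s" using assms by (simp add: level_def)
    show "level N A s \<noteq> {\<one>\<^bsub>?G\<^esub>}" using False by simp
    show "inv\<^bsub>?G\<^esub> b \<in> level N A s" if "b \<in> level N A s" for b
      using that assms(1) by (auto simp: level_def car)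
    show "K = {\<one>\<^bsub>?G\<^esub>}" if "subgroup K ?G" "K \<subseteq> ((\<lambda>X. X <#>\<^bsub>?G\<^esub> level N A s) ^^ j) {\<one>\<^bsub>?G\<^esub>}" for K
      using nosub[OF that(1)] that(2) sub by auto
  qed
  also have "\<dots> \<le> 2 * card (level N A s0)"
    using sub by (intro mult_left_mono card_mono) auto
  finally have "real j * real (card (level N A s)) \<le> 2 * real (card (level N A s0))"
    by (metis of_nat_le_iff of_nat_mult of_nat_numeral)
  also have "\<dots> \<le> 2 * (2 * real N / real (card A))"
    using card_level_le[OF assms(1,2,3), of s0] assms by simp
  finally have main: "real j * real (card (level N A s)) \<le> 4 * real N / real (card A)" by simp
  have "s0 / s \<le> 2 * real j" using j by linarith
  then have "s0 / s * real (card (level N A s)) \<le> 2 * real j * real (card (level N A s))"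
    by (rule mult_right_mono) simp
  then have "s0 / s * real (card (level N A s)) \<le> 8 * real N / real (card A)"
    using main by simp
  then have "real (card (level N A s)) \<le> 8 * real N * s / (real (card A) * s0)"
    using assms n by (simp add: field_simps)
  moreover have "card (level N A s - {0}) \<le> card (level N A s)" by (intro card_mono) auto
  ultimately show ?thesis by linarith
qed

subsection \<open>Sums of random subsets\<close>

lemma set_sum_eq:
  assumes "N > 0" "R \<subseteq> {0..<int N}"
  shows "set_sum N R = (\<Sum>R) mod int N"
proof -
  interpret comm_group "integer_mod_group N" by simp
  have car: "carrier (integer_mod_group N) = {0..<int N}" using assms(1) by (simp add: carrier_integer_mod_group)
  have "finite R" using assms(2) finite_subset by blast
  then show ?thesis using assms(2)
  proof (induction R rule: finite_induct)
    case (insert x R)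
    then have "set_sum N (insert x R) = (x + set_sum N R) mod int N"
      unfolding set_sum_def by (subst finprod_insert) (auto simp: car)
    then show ?case using insert by (simp add: mod_add_right_eq)
  qed (simp add: set_sum_def)
qed

definition fibre :: "nat \<Rightarrow> int set \<Rightarrow> nat \<Rightarrow> int \<Rightarrow> int set set" where
  "fibre N A m z = {R \<in> {R. R \<subseteq> A \<and> card R = m}. \<Sum>R mod int N = z}"

lemma prob_set_sum_eq:
  assumes "N > 0" "A \<subseteq> {0..<int N}" "m \<le> card A"
  shows "measure_pmf.prob (unif_subset m A) {R. set_sum N R = z}
    = real (card (fibre N A m z)) / real (card A choose m)"
proof -
  let ?F = "{R. R \<subseteq> A \<and> card R = m}"
  have fin: "finite A" using assms(2) finite_subset by blast
  have "?F \<noteq> {}" using obtain_subset_with_card_n[OF assms(3)] by blast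
  moreover have "finite ?F" using fin by simp
  moreover have "?F \<inter> {R. set_sum N R = z} = fibre N A m z"
    unfolding fibre_def using set_sum_eq[OF assms(1)] assms(2) by auto
  ultimately show ?thesis
    using fin by (simp add: unif_subset_def measure_pmf_of_set n_subsets)
qed

text \<open>Once all but one element of \<open>R\<close> are fixed, at most one choice of the last
  element gives the sum \<open>z\<close>.\<close>

lemma card_fibre_mult_le:
  assumes "N > 0" "A \<subseteq> {0..<int N}" "1 \<le> m" "m \<le> card A"
  shows "(card A - m + 1) * card (fibre N A m z) \<le> card A choose m"
proof -
  have fin: "finite A" using assms(2) finite_subset by blast
  let ?S = "Sigma (fibre N A m z) (\<lambda>R. R)"
  let ?f = "\<lambda>(R, x). R - {x}"
  have finR: "finite R" if "R \<in> fibre N A m z" for R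
    using that fin finite_subset by (auto simp: fibre_def)
  have finF: "finite (fibre N A m z)" unfolding fibre_def using fin by simp
  have "inj_on ?f ?S"
  proof (rule inj_onI)
    fix p p' assume p: "p \<in> ?S" "p' \<in> ?S" "?f p = ?f p'"
    obtain R x R' x' where eq: "p = (R, x)" "p' = (R', x')" by fastforce
    have mem: "R \<in> fibre N A m z" "x \<in> R" "R' \<in> fibre N A m z" "x' \<in> R'" and d: "R - {x} = R' - {x'}"
      using p eq by auto
    have "\<Sum>R = x + \<Sum>(R - {x})" "\<Sum>R' = x' + \<Sum>(R - {x})"
      unfolding d using sum.remove[OF finR mem(2)] sum.remove[OF finR mem(4)] mem(1,3) d by simp_all
    moreover have "\<Sum>R mod int N = \<Sum>R' mod int N" using mem(1,3) by (simp add: fibre_def)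
    ultimately have "(x + \<Sum>(R - {x})) mod int N = (x' + \<Sum>(R - {x})) mod int N" by (simp only:)
    then have "int N dvd x - x'" by (simp add: mod_eq_dvd_iff)
    moreover have "x \<in> {0..<int N}" "x' \<in> {0..<int N}" using mem assms(2) by (auto simp: fibre_def)
    ultimately have "x = x'" by (metis atLeastLessThan_iff mod_eq_dvd_iff mod_pos_pos_trivial)
    then show "p = p'" using eq d mem by blast
  qed
  moreover have "?f ` ?S \<subseteq> {R. R \<subseteq> A \<and> card R = m - 1}"
  proof
    fix Q assume "Q \<in> ?f ` ?S"
    then obtain R x where "R \<in> fibre N A m z" "x \<in> R" "Q = R - {x}" by auto
    moreover from this have "R \<subseteq> A" "card R = m" by (simp_all add: fibre_def)
    ultimately show "Q \<in> {R. R \<subseteq> A \<and> card R = m - 1}" using finR[of R] by auto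
  qed
  ultimately have "card ?S \<le> card {R. R \<subseteq> A \<and> card R = m - 1}"
    using fin by (intro card_inj_on_le[of ?f]) auto
  moreover have "card ?S = m * card (fibre N A m z)"
  proof -
    have "card ?S = (\<Sum>R\<in>fibre N A m z. card R)" using finF finR by (intro card_SigmaI) auto
    also have "\<dots> = (\<Sum>R\<in>fibre N A m z. m)" by (intro sum.cong) (simp_all add: fibre_def)
    finally show ?thesis by simp
  qed
  ultimately have "m * card (fibre N A m z) \<le> card A choose (m - 1)"
    using fin by (simp add: n_subsets)
  then have "(card A - m + 1) * (m * card (fibre N A m z)) \<le> (card A - m + 1) * (card A choose (m - 1))"
    by (rule mult_left_mono) simp
  also have "\<dots> = m * (card A choose m)"
  proof -
    obtain k where k: "m = Suc k" using assms(3) by (cases m) auto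
    have "Suc k * (card A choose Suc k) = (card A - k) * (card A choose k)"
      by (rule Suc_times_binomial_Suc)
    moreover have "card A - m + 1 = card A - k" "m - 1 = k" using k assms(4) by simp_all
    ultimately show ?thesis using k by (simp only:)
  qed
  finally have "m * ((card A - m + 1) * card (fibre N A m z)) \<le> m * (card A choose m)"
    by (simp only: mult.left_commute)
  then show ?thesis using assms(3) by simp
qed

text \<open>Beyond \<open>s0\<close> the frequencies are not counted but all charged exp(-c m s0^2);
  up to \<open>s0\<close> their number is linear in the scale.\<close>

lemma sum_exp_defect_le:
  fixes c :: real
  assumes "N > 0" "A \<subseteq> {0..<int N}" "A \<noteq> {}" "0 < s0" "s0 \<le> 1/2" "0 < c" "1 \<le> m"
    and nosub: "\<And>K. subgroup K (integer_mod_group N) \<Longrightarrow> K \<subseteq> level N A s0 \<Longrightarrow> K = {0}"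
  shows "(\<Sum>k\<in>{1..<int N}. exp (- (c * real m * (defect N A k / real (card A))\<^sup>2)))
    \<le> real N * (exp (- (c * real m * s0\<^sup>2)) + 8 / (s0 * (1 - exp (- c))\<^sup>2) / (real (card A) * sqrt (real m)))"
proof -
  define x where "x k = defect N A k / real (card A)" for k
  define g where "g k = exp (- (c * real m * (x k)\<^sup>2))" for k
  define D where "D = {k \<in> {1..<int N}. x k \<le> s0}"
  define Q where "Q = 8 * real N / (real (card A) * s0)"
  have n: "card A > 0" using assms finite_subset[OF assms(2)] by (simp add: card_gt_0_iff)
  have finD: "finite D" by (rule finite_subset[of _ "{1..<int N}"]) (auto simp: D_def)
  have count: "real (card {k \<in> D. x k \<le> s}) \<le> Q * s" if "0 < s" for s
  proof -
    \<comment> \<open>\<open>D\<close> stops at \<open>s0\<close>, so the linear count, available up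
      to \<open>s0\<close>, extends to every scale through the minimum.\<close>
    have "{k \<in> D. x k \<le> s} \<subseteq> level N A (min s s0) - {0}"
      using n by (auto simp: D_def x_def level_def min_def field_simps)
    then have "real (card {k \<in> D. x k \<le> s}) \<le> real (card (level N A (min s s0) - {0}))"
      by (intro of_nat_mono card_mono) auto
    also have "\<dots> \<le> 8 * real N * min s s0 / (real (card A) * s0)"
      using assms(4) that by (intro card_level_growth assms nosub) auto
    also have "\<dots> \<le> 8 * real N * s / (real (card A) * s0)"
      using assms(4) n by (intro divide_right_mono mult_left_mono) auto
    finally show ?thesis by (simp add: Q_def)
  qed
  have Q: "0 \<le> Q" using assms by (simp add: Q_def)
  have "(\<Sum>k\<in>{1..<int N}. g k) = (\<Sum>k\<in>{1..<int N} - D. g k) + (\<Sum>k\<in>D. g k)"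
    by (rule sum.subset_diff) (auto simp: D_def)
  also have "(\<Sum>k\<in>{1..<int N} - D. g k) \<le> (\<Sum>k\<in>{1..<int N} - D. exp (- (c * real m * s0\<^sup>2)))"
  proof (rule sum_mono)
    fix k assume "k \<in> {1..<int N} - D"
    then have "s0\<^sup>2 \<le> (x k)\<^sup>2" using assms(4) by (intro power_mono) (auto simp: D_def)
    then show "g k \<le> exp (- (c * real m * s0\<^sup>2))" using assms(6) by (simp add: g_def mult_left_mono)
  qed
  also have "\<dots> \<le> real N * exp (- (c * real m * s0\<^sup>2))"
  proof -
    have "card ({1..<int N} - D) \<le> card {1..<int N}" by (intro card_mono) auto
    then show ?thesis by simp
  qed
  also have "(\<Sum>k\<in>D. g k) \<le> Q / sqrt (real m) / (1 - exp (- c))\<^sup>2"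
    unfolding g_def using assms n
    by (intro sum_exp_square_le_of_linear_count finD count Q) (auto simp: x_def)
  also have "\<dots> = real N * (8 / (s0 * (1 - exp (- c))\<^sup>2) / (real (card A) * sqrt (real m)))"
    by (simp add: Q_def mult_ac)
  finally show ?thesis by (simp add: g_def x_def distrib_left)
qed

lemma card_fibre_le:
  fixes \<epsilon> s0 :: real
  assumes "N > 0" "A \<subseteq> {0..<int N}" "1 \<le> m" "real m \<le> (1 - \<epsilon>) * real (card A)" "0 < \<epsilon>"
    and s0: "0 < s0" "s0 \<le> 1/2"
    and nosub: "\<And>K. subgroup K (integer_mod_group N) \<Longrightarrow> K \<subseteq> level N A s0 \<Longrightarrow> K = {0}"
    and z: "z \<in> {0..<int N}"
  shows "real (card (fibre N A m z)) / real (card A choose m) \<le> 1 / real N +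
    96 / sqrt \<epsilon> * (exp (- (\<epsilon> / 4 * real m * s0\<^sup>2)) + 8 / (s0 * (1 - exp (- (\<epsilon> / 4)))\<^sup>2) / (real (card A) * sqrt (real m)))"
proof -
  let ?F = "{R. R \<subseteq> A \<and> card R = m}"
  define B where "B = real (card A choose m)"
  define c where "c = \<epsilon> / 4"
  define Y where "Y = exp (- (c * real m * s0\<^sup>2)) + 8 / (s0 * (1 - exp (- c))\<^sup>2) / (real (card A) * sqrt (real m))"
  have fin: "finite A" using assms(2) finite_subset by blast
  have n: "card A > 0" using assms by (cases "card A = 0") auto
  then have Ane: "A \<noteq> {}" by auto
  have "real m \<le> real (card A)"
    using assms(4) mult_right_mono[of "1 - \<epsilon>" 1 "real (card A)"] assms(5) by simp
  then have B: "B > 0" by (simp add: B_def)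
  have c: "c > 0" using assms(5) by (simp add: c_def)
  have coeff: "cmod (\<Sum>R\<in>?F. root_char N (k * \<Sum>R))
     \<le> 96 / sqrt \<epsilon> * B * exp (- (c * real m * (defect N A k / real (card A))\<^sup>2))" for k
  proof -
    define y where "y = cmod (exp_sum N A k) / real (card A)"
    have "cmod (\<Sum>R\<in>?F. root_char N (k * \<Sum>R)) = cmod (\<Sum>R\<in>?F. \<Prod>a\<in>R. cis (2 * pi * of_int (k * a) / real N))"
      by (simp only: sum_distrib_left root_char_sum) (simp only: root_char_def)
    also have "\<dots> \<le> 96 / sqrt \<epsilon> * B * exp (- (c * real m * (1 - y)))"
      using norm_elementary_symmetric_cis_le[OF fin assms(3,4,5), of "\<lambda>a. 2 * pi * of_int (k * a) / real N"]
      by (simp only: B_def c_def y_def exp_sum_def root_char_def)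
    also have "\<dots> \<le> 96 / sqrt \<epsilon> * B * exp (- (c * real m * (defect N A k / real (card A))\<^sup>2))"
    proof -
      \<comment> \<open>The product bound has 1 - y in its exponent, the defect measures (1 - y^2) /
        2; they compare through (1 - y)^2 >= 0.\<close>
      have "(defect N A k / real (card A))\<^sup>2 = (1 - y\<^sup>2) / 2"
        using n by (simp add: power_divide defect_square y_def field_simps)
      also have "\<dots> \<le> 1 - y"
        using zero_le_power2[of "1 - y"] by (simp add: power2_eq_square field_simps)
      finally have "c * real m * (defect N A k / real (card A))\<^sup>2 \<le> c * real m * (1 - y)"
        using c by (intro mult_left_mono) auto
      then show ?thesis using B assms(5) by (intro mult_left_mono) auto
    qed
    finally show ?thesis .
  qed
  have "real N * real (card (fibre N A m z)) \<le> real (card ?F) + (\<Sum>k\<in>{1..<int N}. cmod (\<Sum>R\<in>?F. root_char N (k * \<Sum>R)))"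
    unfolding fibre_def using fin by (intro card_fibre_mod_le assms(1) z) simp
  also have "real (card ?F) = B" using fin by (simp add: n_subsets B_def)
  also have "(\<Sum>k\<in>{1..<int N}. cmod (\<Sum>R\<in>?F. root_char N (k * \<Sum>R)))
     \<le> (\<Sum>k\<in>{1..<int N}. 96 / sqrt \<epsilon> * B * exp (- (c * real m * (defect N A k / real (card A))\<^sup>2)))"
    by (intro sum_mono coeff)
  also have "\<dots> \<le> 96 / sqrt \<epsilon> * B * (real N * Y)"
    unfolding sum_distrib_left[symmetric] Y_def using B assms(5)
    by (intro mult_left_mono sum_exp_defect_le assms(1,2,3) Ane s0 c nosub) auto
  finally have "real N * real (card (fibre N A m z)) \<le> real N * (B * (1 / real N + 96 / sqrt \<epsilon> * Y))"
    using assms(1) by (simp add: algebra_simps)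
  then have "real (card (fibre N A m z)) \<le> B * (1 / real N + 96 / sqrt \<epsilon> * Y)"
    using assms(1) by (simp add: mult_le_cancel_left_pos)
  then have "real (card (fibre N A m z)) / B \<le> 1 / real N + 96 / sqrt \<epsilon> * Y"
    using B by (simp add: pos_divide_le_eq mult.commute)
  then show ?thesis by (simp only: B_def Y_def c_def)
qed

section \<open>Subgroups that are not q-large, and the final case distinction\<close>

text \<open>The order of \<open>H\<close> divides t q by Lagrange and shares no prime with
  \<open>q\<close>, so it divides \<open>t\<close>.\<close>

lemma card_le_of_not_q_large:
  assumes "N = t * q" "1 \<le> t" "1 \<le> q" "coprime t q" "subgroup H (integer_mod_group N)" "\<not> q_large q H"
  shows "card H \<le> t"
proof -
  interpret group "integer_mod_group N" by simp
  have N: "N > 0" using assms by simp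
  have "card (rcosets\<^bsub>integer_mod_group N\<^esub> H) * card H = N"
    using lagrange[OF assms(5)] N by (simp add: Coset.order_def carrier_integer_mod_group)
  then have dvd: "card H dvd t * q" using assms(1) by (metis dvd_triv_right)
  have "coprime (card H) q"
  proof (rule ccontr)
    assume "\<not> ?thesis"
    then obtain p where "prime p" "p dvd card H" "p dvd q"
      using prime_factor_nat[of "gcd (card H) q"] by (auto simp: coprime_iff_gcd_eq_1)
    then have "q_large q H" using assms(3) unfolding q_large_def by (auto simp: prime_factors_dvd)
    then show False using assms(6) by blast
  qed
  then have "card H dvd t" using dvd by (simp add: coprime_dvd_mult_left_iff)
  then show ?thesis using assms(2) by (intro dvd_imp_le) auto
qed

theorem theorem3p10:
  fixes T L :: nat and \<epsilon> \<nu> :: real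
  assumes "T \<ge> 1" and "L \<ge> 1"
    and "0 < \<epsilon>" and "\<epsilon> < 1" and "0 < \<nu>" and "\<nu> < 1"
  shows "\<exists>C::real. C > 0 \<and>
    (\<forall>(N::nat) (t::nat) (q::nat) (A::int set) (n::nat).
       N = t * q \<and> 1 \<le> t \<and> t \<le> T \<and> 1 \<le> q \<and> coprime t q \<and> num_prime_factors q \<le> L \<and>
       A \<subseteq> carrier (integer_mod_group N) \<and> card A = n \<and> n \<ge> 2 \<longrightarrow>
       (concentrated_on_coset N q \<nu> A \<or>
        (\<forall>m::nat. 1 \<le> m \<and> real m \<le> (1 - \<epsilon>) * real n \<longrightarrow>
          (\<forall>z \<in> carrier (integer_mod_group N).
             measure_pmf.prob (unif_subset m A) {R. set_sum N R = z}
               \<le> 1 / real N + C * (sqrt (ln (2 + real n)) / (real n * sqrt (real m)))))) \<and>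
       (q = 1 \<longrightarrow> \<not> concentrated_on_coset N q \<nu> A))"
proof -
  \<comment> \<open>2 s0^2 <= \<nu> turns concentration 1 - 2 s0^2 into 1 - \<nu>; the minimum with
    1/2 keeps s0 <= 1/2, as the Parseval bound on level sets requires.\<close>
  define s0 where "s0 = sqrt (min \<nu> (1/2) / 2)"
  define c where "c = \<epsilon> / 4"
  \<comment> \<open>Makes c m s0^2 >= 2 log(2 + n) as soon as m >= K log(2 + n).\<close>
  define K where "K = 2 / (c * s0\<^sup>2)"
  \<comment> \<open>\<open>C1\<close>, \<open>C2\<close>, \<open>C3\<close> serve bounded n, large m
    and small m respectively; the final constant is their sum.\<close>
  define C1 where "C1 = (real T / (1 - \<nu>))\<^sup>2"
  define C2 where "C2 = 96 / sqrt \<epsilon> * (1 + 8 / (s0 * (1 - exp (- c))\<^sup>2))"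
  define C3 where "C3 = sqrt K / \<epsilon>"
  have s0: "0 < s0" "s0\<^sup>2 = min \<nu> (1/2) / 2" using assms by (auto simp: s0_def)
  have s0_le: "s0 \<le> 1/2"
    unfolding s0_def by (rule real_le_lsqrt) (auto simp: power2_eq_square)
  have c: "0 < c" using assms by (simp add: c_def)
  have K: "K > 0" using c s0(1) by (simp add: K_def)
  have "0 < 1 + 8 / (s0 * (1 - exp (- c))\<^sup>2)" using s0(1) by (intro add_pos_nonneg) auto
  then have "C2 > 0" unfolding C2_def using assms(3) by (intro mult_pos_pos divide_pos_pos) auto
  then have C: "C1 \<ge> 0" "C2 > 0" "C3 \<ge> 0"
    using assms K by (auto simp: C1_def C3_def)
  have main: "measure_pmf.prob (unif_subset m A) {R. set_sum N R = z}
      \<le> 1 / real N + (C1 + C2 + C3) * (sqrt (ln (2 + real n)) / (real n * sqrt (real m)))"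
    if h: "N = t * q" "1 \<le> t" "t \<le> T" "1 \<le> q" "coprime t q" "A \<subseteq> carrier (integer_mod_group N)"
      "card A = n" "n \<ge> 2" "\<not> concentrated_on_coset N q \<nu> A"
      "1 \<le> m" "real m \<le> (1 - \<epsilon>) * real n" "z \<in> carrier (integer_mod_group N)"
    for N t q A n m z
  proof -
    have N: "N > 0" using h by simp
    have car: "carrier (integer_mod_group N) = {0..<int N}" using N by (simp add: carrier_integer_mod_group)
    have A: "A \<subseteq> {0..<int N}" and z: "z \<in> {0..<int N}" using h car by auto
    have Ane: "A \<noteq> {}" using h(7,8) by auto
    have mA: "real m \<le> (1 - \<epsilon>) * real (card A)" using h(7,11) by simp
    have "real m \<le> real n" using h(11) mult_right_mono[of "1 - \<epsilon>" 1 "real n"] assms by simp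
    then have mn: "m \<le> n" by simp
    define P where "P = real (card (fibre N A m z)) / real (n choose m)"
    define l where "l = ln (2 + real n)"
    define W where "W = sqrt l / (real n * sqrt (real m))"
    have P: "measure_pmf.prob (unif_subset m A) {R. set_sum N R = z} = P"
      using prob_set_sum_eq[OF N A] mn h(7) by (simp add: P_def)
    have l: "1 \<le> l"
    proof -
      have "exp 1 \<le> 2 + real n" using exp_le h(8) by linarith
      then show ?thesis unfolding l_def by (subst ln_ge_iff) auto
    qed
    have sm: "1 \<le> sqrt (real m)" using h(10) by simp
    have W: "W \<ge> 1 / (real n * sqrt (real m))" "W > 0"
      using l sm h(8) by (auto simp: W_def divide_right_mono)
    have nm: "real n * sqrt (real m) \<le> (real n)\<^sup>2"
    proof -
      have "sqrt (real m) \<le> real n"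
        using mn h(10) by (intro real_le_lsqrt) (auto intro: order_trans[OF _ self_le_power])
      then show ?thesis by (simp add: power2_eq_square mult_left_mono)
    qed
    have "P \<le> 1 / real N + C1 * W \<or> P \<le> 1 / real N + C2 * W \<or> P \<le> 1 / real N + C3 * W"
    \<comment> \<open>When n is bounded in terms of T and \<nu>, the error term
      \<open>C1 * W\<close> is already at least 1.\<close>
    proof (cases "(1 - \<nu>) * real n \<le> real T")
      case True
      then have "real n \<le> real T / (1 - \<nu>)" using assms by (simp add: field_simps)
      then have "real n * sqrt (real m) \<le> C1"
        unfolding C1_def by (intro order_trans[OF nm] power_mono) auto
      then have "1 \<le> C1 * (1 / (real n * sqrt (real m)))" using h(8) sm by simp
      also have "\<dots> \<le> C1 * W" using W C by (intro mult_left_mono) auto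
      finally have "1 \<le> C1 * W" .
      moreover have "P \<le> 1" unfolding P[symmetric] by (rule measure_pmf.prob_le_1)
      ultimately have "P \<le> 1 / real N + C1 * W" by (simp add: add_increasing)
      then show ?thesis by blast
    next
      case False
      \<comment> \<open>A nontrivial subgroup here would put at least (1 - \<nu>) n > T elements of
        \<open>A\<close> into a coset of some proper \<open>H\<close>. As alternative (i) fails,
        \<open>H\<close> is not q-large and has order at most t <= T, a contradiction.\<close>
      have nosub: "K = {0}" if KG: "subgroup K (integer_mod_group N)" "K \<subseteq> level N A s0" for K
      proof (rule ccontr)
        assume K0: "K \<noteq> {0}"
        obtain H a where H: "subgroup H (integer_mod_group N)" "H \<noteq> carrier (integer_mod_group N)"
          "a \<in> carrier (integer_mod_group N)"
          "real (card (A \<inter> (a <#\<^bsub>integer_mod_group N\<^esub> H))) \<ge> (1 - 2 * s0\<^sup>2) * real (card A)"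
          by (rule concentrated_of_subgroup_in_level[OF N A Ane less_imp_le[OF s0(1)] KG(1) K0 KG(2)])
        have "(1 - \<nu>) * real (card A) \<le> (1 - 2 * s0\<^sup>2) * real (card A)"
          using s0 by (intro mult_right_mono) auto
        then have big: "(1 - \<nu>) * real (card A) \<le> real (card (A \<inter> (a <#\<^bsub>integer_mod_group N\<^esub> H)))"
          using H(4) by linarith
        have "\<not> q_large q H"
          using h(9) H big unfolding concentrated_on_coset_def by blast
        then have "card H \<le> t" using card_le_of_not_q_large[OF h(1,2,4,5) H(1)] by blast
        moreover have "card (A \<inter> (a <#\<^bsub>integer_mod_group N\<^esub> H)) \<le> card H"
        proof -
          have HG: "H \<subseteq> carrier (integer_mod_group N)" using H(1) by (rule subgroup.subset)
          have "finite (a <#\<^bsub>integer_mod_group N\<^esub> H)"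
            using finite_subset[OF HG] car by (simp add: group.l_coset_conv_image)
          then have "card (A \<inter> (a <#\<^bsub>integer_mod_group N\<^esub> H)) \<le> card (a <#\<^bsub>integer_mod_group N\<^esub> H)"
            by (intro card_mono) auto
          also have "\<dots> = card H" by (rule group.card_l_coset[OF group_integer_mod_group H(3) HG])
          finally show ?thesis .
        qed
        ultimately show False using big False h(3,7) by simp
      qed
      show ?thesis
      proof (cases "K * l \<le> real m")
        case True
        define Z where "Z = 8 / (s0 * (1 - exp (- c))\<^sup>2)"
        have Z: "Z \<ge> 0" using s0 by (simp add: Z_def)
        have "P \<le> 1 / real N + 96 / sqrt \<epsilon> * (exp (- (c * real m * s0\<^sup>2)) + Z / (real n * sqrt (real m)))"
          using card_fibre_le[OF N A h(10) mA assms(3) s0(1) s0_le nosub z]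
          unfolding P_def Z_def c_def h(7) .
        moreover have "exp (- (c * real m * s0\<^sup>2)) \<le> 1 / (real n * sqrt (real m))"
        proof -
          have "2 * l = K * l * (c * s0\<^sup>2)" using c s0(1) by (simp add: K_def)
          also have "\<dots> \<le> real m * (c * s0\<^sup>2)" using True c by (intro mult_right_mono) auto
          finally have "exp (- (c * real m * s0\<^sup>2)) \<le> exp (- (2 * l))" by (simp add: mult_ac)
          also have "\<dots> = 1 / (2 + real n)\<^sup>2"
          proof -
            have "exp (2 * l) = (2 + real n)\<^sup>2"
              unfolding exp_double by (simp add: l_def add_pos_nonneg)
            then show ?thesis by (simp add: exp_minus inverse_eq_divide)
          qed
          also have "\<dots> \<le> 1 / (real n * sqrt (real m))"
          proof (rule divide_left_mono)
            show "real n * sqrt (real m) \<le> (2 + real n)\<^sup>2"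
              by (rule order_trans[OF nm]) (intro power_mono, auto)
          qed (use h(8) sm in auto)
          finally show ?thesis .
        qed
        ultimately have "P \<le> 1 / real N + 96 / sqrt \<epsilon> * (1 / (real n * sqrt (real m)) + Z / (real n * sqrt (real m)))"
          using assms by (smt (verit, best) divide_nonneg_nonneg mult_left_mono real_sqrt_ge_zero)
        also have "\<dots> = 1 / real N + C2 * (1 / (real n * sqrt (real m)))"
        proof -
          have "1 / x + Z / x = (1 + Z) * (1 / x)" for x by (simp add: add_divide_distrib)
          then show ?thesis unfolding C2_def Z_def[symmetric] by (simp only: mult.assoc)
        qed
        also have "\<dots> \<le> 1 / real N + C2 * W"
          using W C by (intro add_left_mono mult_left_mono) auto
        finally show ?thesis by blast
      next
        case False
        have "sqrt (real m) \<le> sqrt K * sqrt l"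
          using False by (simp add: real_sqrt_mult[symmetric])
        then have "1 / real n \<le> sqrt K * W"
          using h(8) sm by (simp add: W_def field_simps)
        then have e: "1 / (\<epsilon> * real n) \<le> C3 * W"
          using assms(3) by (simp add: C3_def field_simps)
        have "real ((n - m + 1) * card (fibre N A m z)) \<le> real (n choose m)"
          using card_fibre_mult_le[OF N A h(10)] mn h(7) by (metis of_nat_le_iff)
        moreover have "\<epsilon> * real n \<le> real (n - m + 1)"
          using h(11) mn by (simp add: of_nat_diff algebra_simps)
        ultimately have "\<epsilon> * real n * real (card (fibre N A m z)) \<le> real (n choose m)"
          by (smt (verit, best) mult_right_mono of_nat_0_le_iff of_nat_mult)
        then have "P \<le> 1 / (\<epsilon> * real n)"
          using mn assms(3) h(8) by (simp add: P_def field_simps)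
        then have "P \<le> 1 / real N + C3 * W" using e by (smt (verit) divide_nonneg_nonneg of_nat_0_le_iff)
        then show ?thesis by blast
      qed
    qed
    moreover have "0 \<le> C1 * W" "0 \<le> C2 * W" "0 \<le> C3 * W" using C W by auto
    ultimately have "P \<le> 1 / real N + (C1 + C2 + C3) * W" by (auto simp: distrib_right)
    then show ?thesis by (simp only: P W_def l_def)
  qed
  \<comment> \<open>1 has no prime factor, so no subgroup is large with respect to it.\<close>
  have one: "\<not> concentrated_on_coset N 1 \<nu> A" for N A
    by (simp add: concentrated_on_coset_def q_large_def)
  show ?thesis
  proof (intro exI[of _ "C1 + C2 + C3"] conjI allI impI)
    show "0 < C1 + C2 + C3" using C by simp
  next
    fix N t q A n
    assume h: "N = t * q \<and> 1 \<le> t \<and> t \<le> T \<and> 1 \<le> q \<and> coprime t q \<and> num_prime_factors q \<le> L \<and>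
       A \<subseteq> carrier (integer_mod_group N) \<and> card A = n \<and> n \<ge> 2"
    show "concentrated_on_coset N q \<nu> A \<or>
        (\<forall>m::nat. 1 \<le> m \<and> real m \<le> (1 - \<epsilon>) * real n \<longrightarrow>
          (\<forall>z \<in> carrier (integer_mod_group N).
             measure_pmf.prob (unif_subset m A) {R. set_sum N R = z}
               \<le> 1 / real N + (C1 + C2 + C3) * (sqrt (ln (2 + real n)) / (real n * sqrt (real m)))))"
      using main[of N t q A n] h by blast
  next
    fix N t q n :: nat and A :: "int set"
    assume "q = 1"
    then show "\<not> concentrated_on_coset N q \<nu> A" using one by simp
  qed
qed

end
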